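(* Let $M$ be a perfect matching, with vertex set in general position (no three collinear), all of whose segments are vertical or horizontal. Then $M$ has an extension $L$ such that the associated dual multigraph $G$ has an edge-partition into two trees, and for every segment $vw$ of $M$ the edge of $G$ corresponding to $v$ and the edge of $G$ corresponding to $w$ lie in different trees.
   Context: A perfect matching is a geometric graph with straight-segment edges, no two crossing (meeting other than at a common endpoint), in which every vertex has degree exactly one. Extension: let $C$ be a convex set (possibly the whole plane) containing all segments of $M$. For each endpoint $v$ of a segment $vw\in M$, consider the ray starting at $v$ continuing $vw$ beyond $v$. These rays are drawn one at a time in some order; each is drawn until it first hits a segment of $M$, a previously drawn ray portion, or the boundary of $C$ (or to infinity if unblocked). The resulting set $L$ is an extension of $M$; it subdivides $C$ into $|M|+1$ convex cells, and each vertex of $M$ lies on the boundary of exactly two cells. The dual multigraph $G$ of $L$ has the cells as vertices and, for each vertex $v$ of $M$, one edge (corresponding to $v$) joining the two cells whose boundaries contain $v$. *)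

theory Defs
  imports "HOL-Analysis.Analysis"
begin

section \<open>Perfect matchings in the plane\<close>

type_synonym point = "real \<times> real"

text \<open>An edge is the set of its two endpoints; the segment it is drawn as is its convex hull.\<close>

definition geometric_graph :: "point set \<Rightarrow> point set set \<Rightarrow> bool" where
  "geometric_graph P E \<longleftrightarrow>
     finite P \<and> (\<forall>e\<in>E. \<exists>v\<in>P. \<exists>w\<in>P. v \<noteq> w \<and> e = {v, w})"

definition noncrossing :: "point set set \<Rightarrow> bool" where
  "noncrossing E \<longleftrightarrow>
     (\<forall>e\<in>E. \<forall>f\<in>E. e \<noteq> f \<longrightarrow> convex hull e \<inter> convex hull f \<subseteq> e \<inter> f)"

definition perfect_matching :: "point set \<Rightarrow> point set set \<Rightarrow> bool" where
  "perfect_matching P M \<longleftrightarrow>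
     geometric_graph P M \<and> noncrossing M \<and> (\<forall>v\<in>P. card {e \<in> M. v \<in> e} = 1)"

definition general_position :: "point set \<Rightarrow> bool" where
  "general_position P \<longleftrightarrow>
     (\<forall>a\<in>P. \<forall>b\<in>P. \<forall>c\<in>P. a \<noteq> b \<and> a \<noteq> c \<and> b \<noteq> c \<longrightarrow> \<not> collinear {a, b, c})"

definition axis_parallel :: "point set set \<Rightarrow> bool" where
  "axis_parallel M \<longleftrightarrow> (\<forall>v w. {v, w} \<in> M \<longrightarrow> fst v = fst w \<or> snd v = snd w)"

definition partner :: "point set set \<Rightarrow> point \<Rightarrow> point" where
  "partner M v = (THE w. {v, w} \<in> M)"


section \<open>Extensions\<close>

text \<open>The portion of the ray from \<^term>\<open>v\<close> away from \<^term>\<open>w\<close> up to and including its first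
  point in \<^term>\<open>B\<close>. The obstacle sets used below are closed, so a first point exists whenever
  \<^term>\<open>B\<close> is hit at all; otherwise the portion is the whole ray.\<close>

definition drawn_ray :: "point set \<Rightarrow> point \<Rightarrow> point \<Rightarrow> point set" where
  "drawn_ray B v w =
     {v + t *\<^sub>R (v - w) | t. 0 \<le> t \<and> (\<forall>s. 0 \<le> s \<and> s < t \<longrightarrow> v + s *\<^sub>R (v - w) \<notin> B)}"

text \<open>\<^term>\<open>R\<close> is the union of the ray portions drawn so far. The segment at \<^term>\<open>v\<close> itself is
  not an obstacle, since it meets the ray only in the starting point \<^term>\<open>v\<close>. If \<^term>\<open>v\<close> lies
  on the boundary of \<^term>\<open>C\<close>, the drawn portion is just \<^term>\<open>{v}\<close>.\<close>

primrec draw_rays :: "point set \<Rightarrow> point set set \<Rightarrow> point set \<Rightarrow> point list \<Rightarrow> point set" where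
  "draw_rays C M R [] = R"
| "draw_rays C M R (v # vs) =
     draw_rays C M
       (R \<union> drawn_ray ((\<Union>e \<in> M - {{v, partner M v}}. convex hull e) \<union> R \<union> frontier C)
              v (partner M v))
       vs"

definition extension :: "point set \<Rightarrow> point set set \<Rightarrow> point set \<Rightarrow> bool" where
  "extension C M L \<longleftrightarrow>
     (\<exists>vs. distinct vs \<and> set vs = \<Union>M \<and> L = (\<Union>e\<in>M. convex hull e) \<union> draw_rays C M {} vs)"

definition cells :: "point set \<Rightarrow> point set \<Rightarrow> point set set" where
  "cells C L = components (C - L)"


section \<open>Multigraphs and trees\<close>

record ('v, 'e) multigraph =
  verts :: "'v set"
  edges :: "'e set"
  ends :: "'e \<Rightarrow> 'v set"

definition wf_multigraph :: "('v, 'e) multigraph \<Rightarrow> bool" where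
  "wf_multigraph G \<longleftrightarrow>
     finite (verts G) \<and> finite (edges G) \<and>
     (\<forall>e\<in>edges G. ends G e \<subseteq> verts G \<and> card (ends G e) \<in> {1, 2})"

definition subgraph :: "('v, 'e) multigraph \<Rightarrow> ('v, 'e) multigraph \<Rightarrow> bool" where
  "subgraph H G \<longleftrightarrow>
     verts H \<subseteq> verts G \<and> edges H \<subseteq> edges G \<and> (\<forall>e\<in>edges H. ends H e = ends G e)"

definition connected_graph :: "('v, 'e) multigraph \<Rightarrow> bool" where
  "connected_graph G \<longleftrightarrow>
     verts G \<noteq> {} \<and>
     (\<forall>u\<in>verts G. \<forall>v\<in>verts G. (u, v) \<in> {(x, y). \<exists>e\<in>edges G. ends G e = {x, y}}\<^sup>*)"

text \<open>Loops are cycles of length 1, pairs of parallel edges are cycles of length 2.\<close>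

definition is_cycle :: "('v, 'e) multigraph \<Rightarrow> 'v list \<Rightarrow> 'e list \<Rightarrow> bool" where
  "is_cycle G us es \<longleftrightarrow>
     es \<noteq> [] \<and> length us = length es \<and> distinct us \<and> distinct es \<and>
     set us \<subseteq> verts G \<and> set es \<subseteq> edges G \<and>
     (\<forall>i < length es. ends G (es ! i) = {us ! i, us ! (Suc i mod length us)})"

definition is_tree :: "('v, 'e) multigraph \<Rightarrow> bool" where
  "is_tree T \<longleftrightarrow>
     wf_multigraph T \<and> connected_graph T \<and> (\<nexists>us es. is_cycle T us es)"

definition edge_partition_into_two_trees ::
  "('v, 'e) multigraph \<Rightarrow> ('v, 'e) multigraph \<Rightarrow> ('v, 'e) multigraph \<Rightarrow> bool" where
  "edge_partition_into_two_trees G S T \<longleftrightarrow>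
     subgraph S G \<and> subgraph T G \<and> is_tree S \<and> is_tree T \<and>
     edges S \<union> edges T = edges G \<and> edges S \<inter> edges T = {}"

text \<open>The edge of the dual multigraph corresponding to a vertex \<^term>\<open>v\<close> of the matching is
  \<^term>\<open>v\<close> itself.\<close>

definition dual_multigraph ::
  "point set \<Rightarrow> point set set \<Rightarrow> point set \<Rightarrow> (point set, point) multigraph" where
  "dual_multigraph C M L =
     \<lparr>verts = cells C L, edges = \<Union>M, ends = (\<lambda>v. {c \<in> cells C L. v \<in> frontier c})\<rparr>"

end

theory Submission
  imports Defs
begin

text \<open>Draw all horizontal rays before all vertical ones. A horizontal ray then ends on a vertical
  segment of \<open>M\<close> or on the frontier, and a vertical ray ends on an extended horizontal segment or on
  the frontier. One tree consists of the left endpoints of horizontal and the lower endpoints of vertical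
  segments (the marked endpoints), the other one of the remaining endpoints; the rotation by 180 degrees
  exchanges the two, so only the first has to be treated.

  Cut every extended segment at its marked endpoint and orient both pieces away from it. Following a
  piece to its end and continuing on the piece hit there, one only moves left, right or up after the
  first step, since a downward piece is never hit. These paths therefore gain height along every vertical
  piece and leave the convex set.

  The two paths starting at a marked endpoint \<open>s\<close> together separate the two cells at \<open>s\<close> and avoid all
  other marked endpoints, so the marked edges are acyclic. Conversely, a union of cells that has no jump
  at any marked endpoint has no jump anywhere, by induction from the sources of the flow: a point of an
  extended segment at which such a union jumps would need another jump upstream. So the marked edges
  connect all cells.\<close>

section \<open>Jumps of a set relative to another set\<close>

text \<open>For dense \<open>A\<close>, these are the points at which the indicator of \<open>U\<close>, known on \<open>A\<close> only, is not
  locally constant.\<close>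

definition jump_set :: "'a::topological_space set \<Rightarrow> 'a set \<Rightarrow> 'a set" where
  "jump_set A U = closure (A \<inter> U) \<inter> closure (A - U)"

lemma closed_jump_set: "closed (jump_set A U)"
  unfolding jump_set_def by (intro closed_Int closed_closure)

lemma jump_set_subset_frontier: "jump_set A U \<subseteq> frontier U"
  unfolding jump_set_def frontier_closures by (intro Int_mono closure_mono) auto

lemma jump_set_subset_closure: "jump_set A U \<subseteq> closure A"
  unfolding jump_set_def using closure_mono[of "A \<inter> U" A] by blast

lemma connected_disjoint_jump_set:
  assumes "connected Q" "Q \<subseteq> closure A" "Q \<inter> jump_set A U = {}" "p \<in> Q \<inter> A" "q \<in> Q \<inter> A"
  shows "p \<in> U \<longleftrightarrow> q \<in> U"
proof -
  have "closure A = closure (A \<inter> U) \<union> closure (A - U)"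
    by (metis Int_Diff_Un closure_Un)
  then have "closure (A \<inter> U) \<inter> Q = {} \<or> closure (A - U) \<inter> Q = {}"
    using assms(1-3) unfolding jump_set_def by (intro connected_closedD) auto
  then show ?thesis
    using assms(4,5) closure_subset[of "A \<inter> U"] closure_subset[of "A - U"] by blast
qed

lemma in_closure_Int_open: "w \<in> closure B \<Longrightarrow> open Z \<Longrightarrow> w \<in> Z \<Longrightarrow> w \<in> closure (B \<inter> Z)"
  using open_Int_closure_subset[of Z B] by (auto simp: Int_commute)

lemma in_closure_Int_eventually:
  assumes "w \<in> closure B" "\<forall>\<^sub>F z in nhds w. z \<in> B \<longrightarrow> z \<in> E"
  shows "w \<in> closure (B \<inter> E)"
proof -
  obtain Z where "open Z" "w \<in> Z" "\<forall>z\<in>Z. z \<in> B \<longrightarrow> z \<in> E"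
    using assms(2) unfolding eventually_nhds by blast
  then show ?thesis
    using in_closure_Int_open[OF assms(1)] closure_mono[of "B \<inter> Z" "B \<inter> E"] by blast
qed

lemma jump_set_Int_open:
  assumes "w \<in> jump_set A U" "open Z" "w \<in> Z"
  shows "w \<in> jump_set A (U \<inter> Z)"
proof -
  have "w \<in> closure (A \<inter> U \<inter> Z)" "w \<in> closure (A - U)"
    using assms in_closure_Int_open unfolding jump_set_def by blast+
  moreover have "A \<inter> U \<inter> Z \<subseteq> A \<inter> (U \<inter> Z)" "A - U \<subseteq> A - U \<inter> Z" by auto
  ultimately show ?thesis unfolding jump_set_def using closure_mono by blast
qed

lemma jump_set_sym_diff:
  assumes "w \<in> jump_set A U" "w \<notin> frontier V"
  shows "w \<in> jump_set A (sym_diff U V)"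
proof -
  have U: "w \<in> closure (A \<inter> U \<inter> Z)" "w \<in> closure ((A - U) \<inter> Z)" if "open Z" "w \<in> Z" for Z
    using assms(1) in_closure_Int_open that unfolding jump_set_def by blast+
  consider "w \<in> interior V" | "w \<in> - closure V" using assms(2) unfolding frontier_def by blast
  then show ?thesis
  proof cases
    case 1
    have "A \<inter> U \<inter> interior V \<subseteq> A - sym_diff U V" "(A - U) \<inter> interior V \<subseteq> A \<inter> sym_diff U V"
      using interior_subset[of V] by auto
    then show ?thesis unfolding jump_set_def using U[of "interior V"] 1 closure_mono by blast
  next
    case 2
    have "A \<inter> U \<inter> - closure V \<subseteq> A \<inter> sym_diff U V" "(A - U) \<inter> - closure V \<subseteq> A - sym_diff U V"
      using closure_subset[of V] by auto
    then show ?thesis unfolding jump_set_def using U[of "- closure V"] 2 closure_mono by blast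
  qed
qed

lemma frontier_sym_diff_subset: "frontier (sym_diff U V) \<subseteq> frontier U \<union> frontier V"
  using frontier_Un_subset[of "U - V" "V - U"] frontier_Int_subset[of U "- V"]
    frontier_Int_subset[of V "- U"] unfolding Diff_eq frontier_complement by blast

definition two_sided_at :: "'a::topological_space set \<Rightarrow> 'a \<Rightarrow> bool" where
  "two_sided_at A s \<longleftrightarrow>
     (\<exists>N N'. connected N \<and> connected N' \<and> N \<union> N' \<subseteq> A \<and> s \<notin> closure (A - (N \<union> N')))"

text \<open>Says that \<open>S\<close>, as a set of dual edges, is a spanning tree of the components of \<open>A\<close>: an edge joins at
  most two components, every cut is crossed by an edge, and every edge is the only one crossing some
  cut.\<close>

definition spans_dual_tree :: "'a::topological_space set \<Rightarrow> 'a set \<Rightarrow> bool" where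
  "spans_dual_tree A S \<longleftrightarrow> (\<forall>s\<in>S. two_sided_at A s) \<and>
     (\<forall>U. jump_set A U \<inter> (A \<union> S) = {} \<longrightarrow> A \<subseteq> U \<or> A \<inter> U = {}) \<and>
     (\<forall>s\<in>S. \<exists>U. jump_set A U \<inter> (A \<union> S) = {s})"

lemma
  assumes "spans_dual_tree A S"
  shows spans_dual_tree_two_sided: "s \<in> S \<Longrightarrow> two_sided_at A s"
    and spans_dual_tree_no_jump: "jump_set A U \<inter> (A \<union> S) = {} \<Longrightarrow> A \<subseteq> U \<or> A \<inter> U = {}"
    and spans_dual_tree_single_jump: "s \<in> S \<Longrightarrow> \<exists>U. jump_set A U \<inter> (A \<union> S) = {s}"
  using assms by (simp_all add: spans_dual_tree_def)

lemma closure_uminus_image: "closure (uminus ` B) = uminus ` closure B"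
  for B :: "'a::real_normed_vector set"
  using closure_scaleR[of "-1" B] by simp

lemma jump_set_uminus: "jump_set (uminus ` A) (uminus ` U) = uminus ` jump_set A U"
  for A :: "'a::real_normed_vector set"
  unfolding jump_set_def
  by (metis closure_uminus_image image_Int image_set_diff inj_uminus)

lemma two_sided_at_uminus:
  fixes A :: "'a::real_normed_vector set"
  assumes "two_sided_at A s"
  shows "two_sided_at (uminus ` A) (- s)"
proof -
  obtain N N' where N: "connected N" "connected N'" "N \<union> N' \<subseteq> A" "s \<notin> closure (A - (N \<union> N'))"
    using assms unfolding two_sided_at_def by blast
  have "connected (uminus ` B)" if "connected B" for B :: "'a set"
    using that by (rule connected_continuous_image[OF continuous_on_minus[OF continuous_on_id]])
  moreover have "closure (uminus ` A - (uminus ` N \<union> uminus ` N')) = uminus ` closure (A - (N \<union> N'))"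
    by (metis closure_uminus_image image_Un image_set_diff inj_uminus)
  then have "- s \<notin> closure (uminus ` A - (uminus ` N \<union> uminus ` N'))"
    using N(4) by (simp add: inj_image_mem_iff)
  ultimately show ?thesis
    unfolding two_sided_at_def using N(1-3)
    by (intro exI[of _ "uminus ` N"] exI[of _ "uminus ` N'"]) auto
qed

lemma spans_dual_tree_uminus:
  fixes A :: "'a::real_normed_vector set"
  assumes "spans_dual_tree A S"
  shows "spans_dual_tree (uminus ` A) (uminus ` S)"
proof -
  have jump: "jump_set (uminus ` A) U \<inter> (uminus ` A \<union> uminus ` S) =
      uminus ` (jump_set A (uminus ` U) \<inter> (A \<union> S))" for U
  proof -
    have "jump_set (uminus ` A) U = uminus ` jump_set A (uminus ` U)"
      using jump_set_uminus[of A "uminus ` U"] by (simp add: image_image)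
    then show ?thesis by (simp add: image_Int[OF inj_uminus] image_Un)
  qed
  have "uminus ` A \<subseteq> U \<or> uminus ` A \<inter> U = {}"
    if "jump_set (uminus ` A) U \<inter> (uminus ` A \<union> uminus ` S) = {}" for U
  proof -
    have "A \<subseteq> uminus ` U \<or> A \<inter> uminus ` U = {}"
      using that assms by (intro spans_dual_tree_no_jump) (simp_all add: jump)
    then show ?thesis by force
  qed
  moreover have "\<exists>U. jump_set (uminus ` A) U \<inter> (uminus ` A \<union> uminus ` S) = {- s}" if s: "s \<in> S" for s
  proof -
    obtain U where "jump_set A U \<inter> (A \<union> S) = {s}"
      using spans_dual_tree_single_jump[OF assms s] by blast
    then have "jump_set (uminus ` A) (uminus ` U) \<inter> (uminus ` A \<union> uminus ` S) = {- s}"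
      unfolding jump by (simp add: image_image)
    then show ?thesis by blast
  qed
  ultimately show ?thesis
    unfolding spans_dual_tree_def
    using two_sided_at_uminus spans_dual_tree_two_sided[OF assms] by blast
qed

section \<open>Trees and edge cuts\<close>

definition edge_cut :: "('v, 'e) multigraph \<Rightarrow> 'v set \<Rightarrow> 'e set" where
  "edge_cut G X = {e \<in> edges G. ends G e \<inter> X \<noteq> {} \<and> \<not> ends G e \<subseteq> X}"

lemma connected_graphI:
  assumes "verts G \<noteq> {}"
    and ends: "\<And>e. e \<in> edges G \<Longrightarrow> ends G e \<subseteq> verts G \<and> card (ends G e) \<in> {1, 2}"
    and cut: "\<And>X. X \<subseteq> verts G \<Longrightarrow> X \<noteq> {} \<Longrightarrow> edge_cut G X = {} \<Longrightarrow> X = verts G"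
  shows "connected_graph G"
proof -
  let ?R = "{(x, y). \<exists>e\<in>edges G. ends G e = {x, y}}"
  have "{v \<in> verts G. (u, v) \<in> ?R\<^sup>*} = verts G" (is "?X = _") if "u \<in> verts G" for u
  proof (rule cut)
    have "ends G e \<subseteq> ?X" if e: "e \<in> edges G" and x: "x \<in> ends G e \<inter> ?X" for e x
    proof
      fix y assume y: "y \<in> ends G e"
      have "(x, y) \<in> ?R" if "x \<noteq> y"
      proof -
        have "{x, y} = ends G e"
          using ends[OF e] x y that by (intro card_seteq card_ge_0_finite) auto
        then show ?thesis using e by auto
      qed
      then have "(x, y) \<in> ?R\<^sup>*" by (cases "x = y") auto
      then show "y \<in> ?X" using x y ends[OF e] rtrancl_trans[of u x ?R y] by blast
    qed
    then show "edge_cut G ?X = {}" unfolding edge_cut_def by blast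
  qed (use that in auto)
  then show ?thesis unfolding connected_graph_def using assms(1) by blast
qed

lemma not_is_cycle_if_edge_cuts:
  assumes cut: "\<And>e. e \<in> edges G \<Longrightarrow> \<exists>X. edge_cut G X = {e}"
  shows "\<not> is_cycle G us es"
proof
  assume cycle: "is_cycle G us es"
  define n where "n = length es"
  have n: "n > 0" "distinct es" "set es \<subseteq> edges G"
    and ends: "\<And>i. i < n \<Longrightarrow> ends G (es ! i) = {us ! i, us ! (Suc i mod n)}"
    using cycle unfolding is_cycle_def n_def by auto
  have "es ! 0 \<in> edges G" using n n_def by auto
  then obtain X where X: "edge_cut G X = {es ! 0}" using cut by blast
  have step: "us ! i \<in> X \<longleftrightarrow> us ! (Suc i mod n) \<in> X" if "0 < i" "i < n" for i
  proof -
    have "es ! i \<noteq> es ! 0" using n that n_def nth_eq_iff_index_eq[of es i 0] by auto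
    then have "es ! i \<in> edges G - edge_cut G X" using X n(3) that n_def by auto
    then show ?thesis using ends[OF that(2)] unfolding edge_cut_def by auto
  qed
  have "us ! (Suc t mod n) \<in> X \<longleftrightarrow> us ! (Suc 0 mod n) \<in> X" if "t < n" for t
    using that
  proof (induction t)
    case (Suc t)
    then show ?case using step[of "Suc t"] by simp
  qed simp
  from this[of "n - 1"] have "us ! 0 \<in> X \<longleftrightarrow> us ! (Suc 0 mod n) \<in> X" using n(1) by simp
  then have "ends G (es ! 0) \<inter> X = {} \<or> ends G (es ! 0) \<subseteq> X" unfolding ends[OF n(1)] by blast
  moreover have "es ! 0 \<in> edge_cut G X" using X by simp
  ultimately show False unfolding edge_cut_def by blast
qed

section \<open>The dual multigraph of a dissected convex set\<close>

definition dual_subgraph :: "point set \<Rightarrow> point set \<Rightarrow> point set \<Rightarrow> (point set, point) multigraph" where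
  "dual_subgraph C L S = \<lparr>verts = cells C L, edges = S, ends = (\<lambda>v. {c \<in> cells C L. v \<in> frontier c})\<rparr>"

lemma dual_subgraph_simps [simp]:
  "verts (dual_subgraph C L S) = cells C L"
  "edges (dual_subgraph C L S) = S"
  "ends (dual_subgraph C L S) v = {c \<in> cells C L. v \<in> frontier c}"
  by (simp_all add: dual_subgraph_def)

lemma dual_multigraph_eq: "dual_multigraph C M L = dual_subgraph C L (\<Union>M)"
  by (simp add: dual_multigraph_def dual_subgraph_def)

locale convex_dissection =
  fixes C L :: "point set"
  assumes convex_C: "convex C" and interior_C: "interior C \<noteq> {}" and closed_L: "closed L"
    and dense_interior: "interior C \<subseteq> closure (interior C - L)"
begin

abbreviation A :: "point set" where
  "A \<equiv> interior C - L"

lemma A_subset: "A \<subseteq> C - L"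
  using interior_subset[of C] by blast

lemma cell_eq: "c \<in> cells C L \<Longrightarrow> c' \<in> cells C L \<Longrightarrow> z \<in> c \<Longrightarrow> z \<in> c' \<Longrightarrow> c = c'"
  unfolding cells_def using components_eq by blast

lemma Union_cells: "\<Union>(cells C L) = C - L"
  unfolding cells_def by (rule Union_components)

lemma cell_nonempty: "c \<in> cells C L \<Longrightarrow> c \<noteq> {}"
  unfolding cells_def by (rule in_components_nonempty)

lemma connected_subset_cell:
  "c \<in> cells C L \<Longrightarrow> connected N \<Longrightarrow> N \<subseteq> C - L \<Longrightarrow> N \<inter> c \<noteq> {} \<Longrightarrow> N \<subseteq> c"
  unfolding cells_def using components_maximal by blast

lemma cell_relatively_open:
  assumes "c \<in> cells C L"
  obtains Z where "open Z" "c = C \<inter> Z"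
proof -
  have A: "openin (top_of_set C) (C - L)"
    using closed_L by (simp add: Diff_eq openin_open_Int open_Compl)
  have "locally connected (C - L)"
    using convex_imp_locally_connected[OF convex_C] A by (rule locally_open_subset)
  then have "openin (top_of_set (C - L)) c"
    using assms unfolding cells_def by (rule openin_components_locally_connected)
  then show ?thesis using openin_trans[OF _ A] that unfolding openin_open by metis
qed

lemma open_cell_interior:
  assumes "c \<in> cells C L"
  shows "open (c \<inter> interior C)"
proof -
  obtain Z where "open Z" "c = C \<inter> Z" using assms by (rule cell_relatively_open)
  moreover from this have "c \<inter> interior C = Z \<inter> interior C" using interior_subset by blast
  ultimately show ?thesis by auto
qed

lemma cell_Int_A: "c \<in> cells C L \<Longrightarrow> c \<inter> A = c \<inter> interior C"
  using Union_cells by blast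

lemma cell_subset_closure:
  assumes "c \<in> cells C L"
  shows "c \<subseteq> closure (c \<inter> A)"
proof -
  obtain Z where Z: "open Z" "c = C \<inter> Z" using assms by (rule cell_relatively_open)
  have "C \<subseteq> closure (interior C)"
    using convex_closure_interior[OF convex_C interior_C] closure_subset by blast
  then have "c \<subseteq> closure (interior C \<inter> Z)"
    using in_closure_Int_open[of _ "interior C" Z] Z by blast
  also have "interior C \<inter> Z = c \<inter> A"
    using cell_Int_A[OF assms] Z(2) interior_subset[of C] by blast
  finally show ?thesis .
qed

lemma cell_closure_eq: "c \<in> cells C L \<Longrightarrow> closure c = closure (c \<inter> A)"
  by (meson cell_subset_closure closure_minimal closed_closure closure_mono inf_le1 subset_antisym)

lemma cell_meets_A: "c \<in> cells C L \<Longrightarrow> c \<inter> A \<noteq> {}"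
  using cell_subset_closure cell_nonempty by fastforce

lemma cells_nonempty: "cells C L \<noteq> {}"
proof -
  have "A \<noteq> {}" using interior_C dense_interior by force
  then show ?thesis using A_subset Union_cells by blast
qed

text \<open>Near a point of \<open>C - L\<close> the set \<open>A\<close> is convex, even if that point lies on the frontier of \<open>C\<close>.\<close>

lemma jump_set_off_L:
  assumes "jump_set A U \<inter> A = {}"
  shows "jump_set A U \<inter> (C - L) = {}"
proof -
  have False if z: "z \<in> C - L" and jump: "z \<in> jump_set A U" for z
  proof -
    obtain e where e: "e > 0" "ball z e \<subseteq> - L"
      using closed_L z by (meson ComplI DiffD2 openE open_Compl)
    let ?Q = "ball z e \<inter> interior C"
    have Q: "?Q \<subseteq> A" "connected ?Q"
      using e(2) by (auto intro!: convex_connected convex_Int convex_ball convex_interior convex_C)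
    have "p \<in> U \<longleftrightarrow> q \<in> U" if "p \<in> ?Q" "q \<in> ?Q" for p q
      using assms Q(1) closure_subset[of A] that
      by (intro connected_disjoint_jump_set[OF Q(2), of A]) auto
    then have "A \<inter> U \<inter> ball z e = {} \<or> (A - U) \<inter> ball z e = {}" by blast
    moreover have "z \<in> closure (A \<inter> U \<inter> ball z e)" "z \<in> closure ((A - U) \<inter> ball z e)"
      using jump e(1) unfolding jump_set_def by (auto intro: in_closure_Int_open)
    ultimately show False by auto
  qed
  then show ?thesis by blast
qed

lemma cell_constant:
  assumes "jump_set A U \<inter> A = {}" "c \<in> cells C L" "p \<in> c \<inter> A" "q \<in> c \<inter> A"
  shows "p \<in> U \<longleftrightarrow> q \<in> U"
proof (rule connected_disjoint_jump_set[of c A])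
  show "connected c" using assms(2) unfolding cells_def by (rule in_components_connected)
  show "c \<subseteq> closure A"
    using cell_subset_closure[OF assms(2)] closure_mono[of "c \<inter> A" A] by blast
  show "c \<inter> jump_set A U = {}" using jump_set_off_L[OF assms(1)] assms(2) Union_cells by blast
qed (use assms in auto)

lemma jump_set_Union_cells:
  assumes "X \<subseteq> cells C L"
  shows "jump_set A (\<Union>X) \<inter> A = {}"
proof -
  have "w \<notin> jump_set A (\<Union>X)" if w: "w \<in> A" for w
  proof -
    obtain c where c: "c \<in> cells C L" "w \<in> c" using w A_subset Union_cells by blast
    have Z: "open (c \<inter> interior C)" "w \<in> c \<inter> interior C" using open_cell_interior c w by auto
    have "A \<inter> \<Union>X \<inter> (c \<inter> interior C) = {} \<or> (A - \<Union>X) \<inter> (c \<inter> interior C) = {}"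
      using cell_eq[OF c(1)] assms by blast
    moreover have "w \<in> closure (A \<inter> \<Union>X \<inter> (c \<inter> interior C))" "w \<in> closure ((A - \<Union>X) \<inter> (c \<inter> interior C))"
      if "w \<in> jump_set A (\<Union>X)"
      using that in_closure_Int_open[OF _ Z] unfolding jump_set_def by blast+
    ultimately show ?thesis by auto
  qed
  then show ?thesis by blast
qed

context
  fixes S :: "point set"
  assumes finite_S: "finite S" and S_subset_L: "S \<subseteq> L" and spans: "spans_dual_tree A S"
begin

abbreviation ends_at :: "point \<Rightarrow> point set set" where
  "ends_at v \<equiv> {c \<in> cells C L. v \<in> frontier c}"

lemma S_frontier_iff: "s \<in> S \<Longrightarrow> c \<in> cells C L \<Longrightarrow> s \<in> frontier c \<longleftrightarrow> s \<in> closure (c \<inter> A)"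
  using S_subset_L Union_cells interior_subset[of c]
  unfolding frontier_def cell_closure_eq[symmetric] by blast

lemma two_cells_near:
  assumes s: "s \<in> S"
  obtains a b where "s \<notin> closure (A - \<Union>(cells C L \<inter> {a, b}))"
proof -
  obtain N N' where N: "connected N" "connected N'" "N \<union> N' \<subseteq> A" "s \<notin> closure (A - (N \<union> N'))"
    using spans_dual_tree_two_sided[OF spans s] unfolding two_sided_at_def by blast
  have cell: "\<exists>a. Q \<subseteq> \<Union>(cells C L \<inter> {a})" if Q: "connected Q" "Q \<subseteq> A" for Q
  proof (cases "Q = {}")
    case False
    then obtain c where c: "c \<in> cells C L" "Q \<inter> c \<noteq> {}" using Q(2) A_subset Union_cells by blast
    then have "Q \<subseteq> c" using connected_subset_cell Q A_subset by blast
    then show ?thesis using c(1) by (intro exI[of _ c]) simp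
  qed simp
  obtain a b where "N \<subseteq> \<Union>(cells C L \<inter> {a})" "N' \<subseteq> \<Union>(cells C L \<inter> {b})"
    using cell N(1-3) by (metis Un_subset_iff)
  then have "A - \<Union>(cells C L \<inter> {a, b}) \<subseteq> A - (N \<union> N')" by blast
  then show ?thesis using that[of a b] N(4) closure_mono by blast
qed

lemma ends_at_subset_doubleton:
  assumes s: "s \<in> S"
  shows "\<exists>a b. ends_at s \<subseteq> {a, b}"
proof -
  obtain a b where ab: "s \<notin> closure (A - \<Union>(cells C L \<inter> {a, b}))" using s by (rule two_cells_near)
  have "c \<in> {a, b}" if c: "c \<in> ends_at s" for c
  proof (rule ccontr)
    assume "c \<notin> {a, b}"
    then have "c \<inter> A \<subseteq> A - \<Union>(cells C L \<inter> {a, b})" using c cell_eq by blast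
    moreover have "s \<in> closure (c \<inter> A)" using S_frontier_iff[OF s] c by blast
    ultimately show False using ab closure_mono by blast
  qed
  then show ?thesis by blast
qed

lemma ends_at_cover:
  assumes s: "s \<in> S"
  shows "s \<notin> closure (A - \<Union>(ends_at s))"
proof -
  obtain a b where ab: "s \<notin> closure (A - \<Union>(cells C L \<inter> {a, b}))" using s by (rule two_cells_near)
  let ?F = "cells C L \<inter> {a, b} - ends_at s"
  let ?K = "closure (A - \<Union>(cells C L \<inter> {a, b})) \<union> (\<Union>c\<in>?F. closure (c \<inter> A))"
  have "A - \<Union>(ends_at s) \<subseteq> (A - \<Union>(cells C L \<inter> {a, b})) \<union> (\<Union>c\<in>?F. c \<inter> A)" by blast
  also have "\<dots> \<subseteq> ?K" by (intro Un_mono UN_mono closure_subset order_refl)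
  finally have "closure (A - \<Union>(ends_at s)) \<subseteq> ?K"
    by (intro closure_minimal closed_Un closed_UN closed_closure) auto
  moreover have "s \<notin> ?K" using ab S_frontier_iff[OF s] by blast
  ultimately show ?thesis by blast
qed

lemma ends_at_card:
  assumes "s \<in> S"
  shows "card (ends_at s) \<in> {1, 2}"
proof -
  obtain a b where ab: "ends_at s \<subseteq> {a, b}" using ends_at_subset_doubleton[OF assms] by blast
  have "card (ends_at s) \<le> card {a, b}" using ab by (intro card_mono) auto
  also have "\<dots> \<le> 2" by (simp add: card_insert_if)
  finally have "card (ends_at s) \<le> 2" .
  moreover have "ends_at s \<noteq> {}"
  proof
    assume "ends_at s = {}"
    moreover have "s \<in> closure A"
      using spans_dual_tree_single_jump[OF spans assms] jump_set_subset_closure by blast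
    ultimately show False using ends_at_cover[OF assms] by (metis Diff_empty Sup_empty)
  qed
  then have "card (ends_at s) \<noteq> 0" using ab finite_subset[OF ab] by auto
  ultimately show ?thesis by auto
qed

lemma cells_eqI:
  assumes "X \<subseteq> cells C L" "X \<noteq> {}" "edge_cut (dual_subgraph C L S) X = {}"
  shows "X = cells C L"
proof -
  have "s \<notin> jump_set A (\<Union>X)" if s: "s \<in> S" for s
  proof -
    have "ends_at s \<subseteq> X \<or> ends_at s \<inter> X = {}"
      using assms(3) s unfolding edge_cut_def dual_subgraph_simps by blast
    then have "A - \<Union>X \<subseteq> A - \<Union>(ends_at s) \<or> A \<inter> \<Union>X \<subseteq> A - \<Union>(ends_at s)"
      using assms(1) cell_eq by blast
    then show ?thesis
      using ends_at_cover[OF s] closure_mono unfolding jump_set_def by blast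
  qed
  then have "jump_set A (\<Union>X) \<inter> (A \<union> S) = {}" using jump_set_Union_cells[OF assms(1)] by blast
  then have "A \<subseteq> \<Union>X \<or> A \<inter> \<Union>X = {}" by (rule spans_dual_tree_no_jump[OF spans])
  moreover have "A \<inter> \<Union>X \<noteq> {}" using assms(1,2) cell_meets_A by blast
  ultimately have A: "A \<subseteq> \<Union>X" by blast
  have "c \<in> X" if c: "c \<in> cells C L" for c
  proof -
    obtain z where "z \<in> c \<inter> A" using cell_meets_A[OF c] by blast
    then show ?thesis using A assms(1) cell_eq[OF c] by blast
  qed
  then show ?thesis using assms(1) by blast
qed

lemma finite_cells: "finite (cells C L)"
proof -
  obtain c where "c \<in> cells C L" using cells_nonempty by blast
  then have "insert c (\<Union>(ends_at ` S)) = cells C L"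
    by (intro cells_eqI) (auto simp: edge_cut_def)
  moreover have "finite (ends_at s)" if "s \<in> S" for s
    using ends_at_subset_doubleton[OF that] by (meson finite.emptyI finite.insertI finite_subset)
  then have "finite (insert c (\<Union>(ends_at ` S)))" using finite_S by blast
  ultimately show ?thesis by (simp only:)
qed

lemma ends_at_meets:
  assumes "s \<in> S" "s \<in> closure (A \<inter> V)"
  shows "\<exists>c\<in>ends_at s. c \<inter> A \<inter> V \<noteq> {}"
proof -
  have "s \<in> closure (A \<inter> V \<inter> - closure (A - \<Union>(ends_at s)))"
    using assms(2) ends_at_cover[OF assms(1)] by (intro in_closure_Int_open[of _ "A \<inter> V"]) auto
  then have "A \<inter> V \<inter> - closure (A - \<Union>(ends_at s)) \<noteq> {}" by force
  then show ?thesis using closure_subset[of "A - \<Union>(ends_at s)"] by blast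
qed

lemma edge_cut_singleton:
  assumes s: "s \<in> S"
  shows "\<exists>X. edge_cut (dual_subgraph C L S) X = {s}"
proof -
  obtain U where U: "jump_set A U \<inter> (A \<union> S) = {s}"
    using spans_dual_tree_single_jump[OF spans s] by blast
  define X where "X = {c \<in> cells C L. c \<inter> A \<inter> U \<noteq> {}}"
  have jump: "w = s" if "w \<in> A \<union> S" "w \<in> jump_set A U" for w
    using U that by (metis Int_iff singletonD)
  have "s \<notin> A" using s S_subset_L by blast
  then have "jump_set A U \<inter> A = {}" using jump by blast
  then have "c \<inter> A \<subseteq> U" if "c \<in> X" for c
    using cell_constant[of U c] that unfolding X_def by blast
  then have X: "c \<inter> A \<subseteq> A \<inter> U" if "c \<in> X" for c using that by blast
  have not_X: "c \<inter> A \<subseteq> A - U" if "c \<in> cells C L - X" for c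
    using that unfolding X_def by blast
  have "s' \<in> jump_set A U"
    if s': "s' \<in> S" and c: "c \<in> ends_at s'" "c \<in> X" "c' \<in> ends_at s'" "c' \<notin> X" for s' c c'
  proof -
    have "s' \<in> closure (c \<inter> A)" "s' \<in> closure (c' \<inter> A)" using S_frontier_iff[OF s'] c by auto
    then show ?thesis
      unfolding jump_set_def using closure_mono[OF X[OF c(2)]] closure_mono[OF not_X[of c']] c by blast
  qed
  then have "edge_cut (dual_subgraph C L S) X \<subseteq> {s}"
    using jump unfolding edge_cut_def dual_subgraph_simps by blast
  moreover have "s \<in> closure (A \<inter> U)" "s \<in> closure (A \<inter> - U)"
    using U unfolding jump_set_def Diff_eq by blast+
  then obtain c c' where "c \<in> ends_at s" "c \<inter> A \<inter> U \<noteq> {}" "c' \<in> ends_at s" "c' \<inter> A \<inter> - U \<noteq> {}"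
    using ends_at_meets[OF s] by meson
  then have "c \<in> ends_at s \<inter> X" "c' \<in> ends_at s - X" using X[of c'] unfolding X_def by blast+
  then have "s \<in> edge_cut (dual_subgraph C L S) X"
    using s unfolding edge_cut_def dual_subgraph_simps by blast
  ultimately show ?thesis by blast
qed

theorem is_tree_dual_subgraph: "is_tree (dual_subgraph C L S)"
proof -
  have "connected_graph (dual_subgraph C L S)"
    using cells_nonempty ends_at_card cells_eqI by (intro connected_graphI) auto
  moreover have "\<nexists>us es. is_cycle (dual_subgraph C L S) us es"
    using not_is_cycle_if_edge_cuts[of "dual_subgraph C L S"] edge_cut_singleton by simp
  moreover have "wf_multigraph (dual_subgraph C L S)"
    unfolding wf_multigraph_def using finite_cells finite_S ends_at_card by auto
  ultimately show ?thesis unfolding is_tree_def by blast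
qed

end

end

section \<open>Arrangements of extended axis-parallel segments\<close>

lemma eventually_mem_closed_imp: "closed K \<Longrightarrow> \<forall>\<^sub>F z in nhds w. z \<in> K \<longrightarrow> w \<in> K"
  using eventually_nhds_in_open[of "- K" w] by (cases "w \<in> K") (auto elim: eventually_mono)

lemma interior_interval_iff:
  fixes K :: "real set"
  assumes "is_interval K"
  shows "x \<in> interior K \<longleftrightarrow> (\<exists>a\<in>K. a < x) \<and> (\<exists>b\<in>K. x < b)"
proof
  assume "x \<in> interior K"
  then obtain e where e: "e > 0" "ball x e \<subseteq> K" by (auto simp: mem_interior)
  then have "x - e / 2 \<in> K" "x + e / 2 \<in> K" by (auto simp: dist_real_def subset_iff)
  moreover have "x - e / 2 < x" "x < x + e / 2" using e(1) by auto
  ultimately show "(\<exists>a\<in>K. a < x) \<and> (\<exists>b\<in>K. x < b)" by blast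
next
  assume "(\<exists>a\<in>K. a < x) \<and> (\<exists>b\<in>K. x < b)"
  then obtain a b where ab: "a \<in> K" "a < x" "b \<in> K" "x < b" by blast
  have "{a<..<b} \<subseteq> K" using mem_is_interval_1_I[OF assms ab(1,3)] by auto
  then show "x \<in> interior K" using ab interior_maximal[of "{a<..<b}" K] by auto
qed

lemma interval_end:
  fixes K :: "real set"
  assumes K: "closed K" "is_interval K" and p: "p \<in> interior K" and x: "x \<notin> K"
  obtains a where "a \<in> K" "a \<notin> interior K" "a \<in> closed_segment p x"
    "x < p \<Longrightarrow> K \<subseteq> {a..}" "p < x \<Longrightarrow> K \<subseteq> {..a}"
proof -
  have pK: "p \<in> K" using p interior_subset by blast
  have "closed_segment p x \<inter> K \<noteq> {}" "closed_segment p x - K \<noteq> {}" using pK x by auto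
  then obtain a where a: "a \<in> closed_segment p x" "a \<in> frontier K"
    using connected_Int_frontier[OF connected_segment(1)] by blast
  then have aK: "a \<in> K" "a \<notin> interior K"
    using frontier_subset_closed[OF K(1)] by (auto simp: frontier_def)
  show ?thesis
  proof (rule that[OF aK a(1)])
    assume "x < p"
    then have "a < p" using a(1) aK p closed_segment_eq_real_ivl[of p x] by (cases "a = p") auto
    then show "K \<subseteq> {a..}"
      using aK(2) pK by (auto simp: interior_interval_iff[OF K(2)] not_less)
  next
    assume "p < x"
    then have "p < a" using a(1) aK p closed_segment_eq_real_ivl[of p x] by (cases "a = p") auto
    then show "K \<subseteq> {..a}"
      using aK(2) pK by (auto simp: interior_interval_iff[OF K(2)] not_less)
  qed
qed

lemma eventually_near_left_endpoint:
  fixes K R :: "real set"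
  assumes R: "is_interval R" and ab: "a < b" "{a..b} \<subseteq> K" "{a<..<b} \<subseteq> R"
    and a: "a \<in> R \<Longrightarrow> a \<in> interior K"
  shows "\<forall>\<^sub>F x in nhds a. x \<in> R \<longrightarrow> x \<in> K"
proof (cases "a \<in> R")
  case True
  then have "\<forall>\<^sub>F x in nhds a. x \<in> interior K" using a by (intro eventually_nhds_in_open open_interior)
  then show ?thesis by eventually_elim (use interior_subset in blast)
next
  case False
  obtain p where p: "a < p" "p < b" using dense ab(1) by blast
  have "\<forall>\<^sub>F x in nhds a. x \<in> {..<b}" using ab(1) by (intro eventually_nhds_in_open) auto
  then show ?thesis
  proof eventually_elim
    case (elim x)
    have "a < x" if "x \<in> R"
      using mem_is_interval_1_I[OF R that, of p a] p ab(3) False by (cases "a < x") auto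
    then show ?case using elim ab(2) by auto
  qed
qed

lemma two_sided_at_hyperplane:
  fixes f :: "'a::euclidean_space \<Rightarrow> real"
  assumes f: "linear f" and I: "convex I" and near: "\<forall>\<^sub>F z in nhds s. z \<in> I \<longrightarrow> (z \<in> L \<longleftrightarrow> f z = f s)"
  shows "two_sided_at (I - L) s"
proof -
  obtain e where e: "e > 0" "\<And>z. z \<in> ball s e \<Longrightarrow> z \<in> I \<Longrightarrow> z \<in> L \<longleftrightarrow> f z = f s"
    using near by (auto simp: eventually_nhds_metric dist_commute)
  let ?N = "I \<inter> ball s e \<inter> f -` {f s<..}" and ?N' = "I \<inter> ball s e \<inter> f -` {..<f s}"
  have "connected ?N" "connected ?N'"
    by (intro convex_connected convex_Int I convex_ball convex_linear_vimage[OF f] convex_real_interval)+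
  moreover have "?N \<union> ?N' \<subseteq> I - L" using e(2) by auto
  moreover have "ball s e \<inter> (I - L - (?N \<union> ?N')) = {}" using e(2) by force
  then have "s \<notin> closure (I - L - (?N \<union> ?N'))"
    using e(1) open_Int_closure_eq_empty[OF open_ball, of s e] by (metis IntI centre_in_ball empty_iff)
  ultimately show ?thesis unfolding two_sided_at_def by blast
qed

text \<open>The horizontal segment \<open>k\<close> lies at height \<open>ht k\<close> over \<open>{xl k..xr k}\<close> and is extended to \<open>hx k\<close>; the
  vertical segment \<open>j\<close> lies at abscissa \<open>ab j\<close> over \<open>{yb j..yt j}\<close> and is extended to \<open>vy j\<close>. The
  assumptions are invariant under the rotation by 180 degrees. The last four say that inside \<open>I\<close> extended
  horizontal segments end exactly on vertical segments, and extended vertical segments exactly on extended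
  horizontal ones.\<close>

locale extended_segments =
  fixes I :: "point set" and H V :: "'i set"
    and ht xl xr :: "'i \<Rightarrow> real" and hx :: "'i \<Rightarrow> real set"
    and ab yb yt :: "'i \<Rightarrow> real" and vy :: "'i \<Rightarrow> real set"
  assumes open_I: "open I" and convex_I: "convex I"
    and finite_H: "finite H" and finite_V: "finite V"
    and closed_hx: "k \<in> H \<Longrightarrow> closed (hx k)" and is_interval_hx: "k \<in> H \<Longrightarrow> is_interval (hx k)"
    and closed_vy: "j \<in> V \<Longrightarrow> closed (vy j)" and is_interval_vy: "j \<in> V \<Longrightarrow> is_interval (vy j)"
    and inj_ht: "inj_on ht H" and inj_ab: "inj_on ab V"
    and xl_less_xr: "k \<in> H \<Longrightarrow> xl k < xr k" and yb_less_yt: "j \<in> V \<Longrightarrow> yb j < yt j"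
    and segment_subset_hx: "k \<in> H \<Longrightarrow> {xl k..xr k} \<subseteq> hx k"
    and segment_subset_vy: "j \<in> V \<Longrightarrow> {yb j..yt j} \<subseteq> vy j"
    and hsegment_subset_I: "k \<in> H \<Longrightarrow> {xl k<..<xr k} \<times> {ht k} \<subseteq> I"
    and vsegment_subset_I: "j \<in> V \<Longrightarrow> {ab j} \<times> {yb j<..<yt j} \<subseteq> I"
    and ab_neq_end: "k \<in> H \<Longrightarrow> j \<in> V \<Longrightarrow> ab j \<noteq> xl k \<and> ab j \<noteq> xr k"
    and ht_neq_end: "k \<in> H \<Longrightarrow> j \<in> V \<Longrightarrow> ht k \<noteq> yb j \<and> ht k \<noteq> yt j"
    and hx_ends_on_segment: "k \<in> H \<Longrightarrow> x \<in> hx k \<Longrightarrow> x \<notin> interior (hx k) \<Longrightarrow> (x, ht k) \<in> I \<Longrightarrow>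
      \<exists>j\<in>V. ab j = x \<and> ht k \<in> {yb j<..<yt j}"
    and vy_ends_on_hx: "j \<in> V \<Longrightarrow> y \<in> vy j \<Longrightarrow> y \<notin> interior (vy j) \<Longrightarrow> (ab j, y) \<in> I \<Longrightarrow>
      \<exists>k\<in>H. ht k = y \<and> ab j \<in> interior (hx k)"
    and segment_stops_hx: "k \<in> H \<Longrightarrow> j \<in> V \<Longrightarrow> ht k \<in> {yb j<..<yt j} \<Longrightarrow> ab j \<notin> interior (hx k)"
    and hx_stops_vy: "k \<in> H \<Longrightarrow> j \<in> V \<Longrightarrow> ab j \<in> hx k \<Longrightarrow> ht k \<in> interior (vy j) \<Longrightarrow>
      ht k \<in> {yb j<..<yt j}"
begin

abbreviation hline :: "'i \<Rightarrow> point set" where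
  "hline k \<equiv> hx k \<times> {ht k}"

abbreviation vline :: "'i \<Rightarrow> point set" where
  "vline j \<equiv> {ab j} \<times> vy j"

definition L :: "point set" where
  "L = (\<Union>k\<in>H. hline k) \<union> (\<Union>j\<in>V. vline j)"

abbreviation A :: "point set" where
  "A \<equiv> I - L"

lemma L_cases:
  assumes "z \<in> L"
  obtains (horizontal) k where "k \<in> H" "z \<in> hline k" | (vertical) j where "j \<in> V" "z \<in> vline j"
  using assms unfolding L_def by (elim UnE UN_E)

definition marked :: "point set" where
  "marked = (\<lambda>k. (xl k, ht k)) ` H \<union> (\<lambda>j. (ab j, yb j)) ` V"

lemma marked_cases:
  assumes "s \<in> marked"
  obtains (left) k where "k \<in> H" "s = (xl k, ht k)" | (lower) j where "j \<in> V" "s = (ab j, yb j)"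
  using assms unfolding marked_def by (elim UnE imageE)

lemma ht_eq_iff: "k \<in> H \<Longrightarrow> k' \<in> H \<Longrightarrow> ht k = ht k' \<longleftrightarrow> k = k'"
  using inj_ht by (auto dest: inj_onD)

lemma ab_eq_iff: "j \<in> V \<Longrightarrow> j' \<in> V \<Longrightarrow> ab j = ab j' \<longleftrightarrow> j = j'"
  using inj_ab by (auto dest: inj_onD)

lemma xl_in_hx: "k \<in> H \<Longrightarrow> xl k \<in> hx k" and xr_in_hx: "k \<in> H \<Longrightarrow> xr k \<in> hx k"
  using segment_subset_hx xl_less_xr by force+

lemma yb_in_vy: "j \<in> V \<Longrightarrow> yb j \<in> vy j" and yt_in_vy: "j \<in> V \<Longrightarrow> yt j \<in> vy j"
  using segment_subset_vy yb_less_yt by force+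

lemma marked_subset_L: "marked \<subseteq> L"
  unfolding marked_def L_def using xl_in_hx yb_in_vy by auto

lemma finite_marked: "finite marked"
  unfolding marked_def using finite_H finite_V by simp

lemma closed_L: "closed L"
  unfolding L_def
  by (intro closed_Un closed_UN closed_Times closed_hx closed_vy closed_singleton finite_H finite_V ballI)

lemma interior_hx_iff: "k \<in> H \<Longrightarrow> x \<in> interior (hx k) \<longleftrightarrow> (\<exists>a\<in>hx k. a < x) \<and> (\<exists>b\<in>hx k. x < b)"
  by (rule interior_interval_iff[OF is_interval_hx])

lemma interior_vy_iff: "j \<in> V \<Longrightarrow> y \<in> interior (vy j) \<longleftrightarrow> (\<exists>a\<in>vy j. a < y) \<and> (\<exists>b\<in>vy j. y < b)"
  by (rule interior_interval_iff[OF is_interval_vy])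

lemma segment_subset_I:
  assumes "p \<in> I" "q \<in> I"
  shows "closed_segment p q \<subseteq> I"
  using convex_I assms by (rule closed_segment_subset[rotated 2])

lemma row_in_I: "(a, y) \<in> I \<Longrightarrow> (b, y) \<in> I \<Longrightarrow> x \<in> closed_segment a b \<Longrightarrow> (x, y) \<in> I"
  using segment_subset_I[of "(a, y)" "(b, y)"] by (auto simp: closed_segment_same_snd)

lemma column_in_I: "(x, a) \<in> I \<Longrightarrow> (x, b) \<in> I \<Longrightarrow> y \<in> closed_segment a b \<Longrightarrow> (x, y) \<in> I"
  using segment_subset_I[of "(x, a)" "(x, b)"] by (auto simp: closed_segment_same_fst)

lemma is_interval_row: "is_interval {x. (x, y) \<in> I}"
  unfolding is_interval_convex_1 convex_contains_segment using row_in_I by blast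

lemma is_interval_column: "is_interval {y. (x, y) \<in> I}"
  unfolding is_interval_convex_1 convex_contains_segment using column_in_I by blast

lemma half_open_segment_subset_I:
  assumes "s \<in> closure I" "w \<in> I"
  shows "closed_segment s w - {s} \<subseteq> I"
proof -
  have "open_segment s w \<subseteq> I"
    using in_interior_closure_convex_segment[OF convex_I, of w s] assms open_I
    by (simp add: interior_open open_segment_commute)
  then show ?thesis using assms(2) unfolding closed_segment_eq_open by blast
qed

lemma left_end_in_closure_I: "k \<in> H \<Longrightarrow> (xl k, ht k) \<in> closure I"
  using closure_mono[OF hsegment_subset_I] xl_less_xr by (force simp: closure_Times)

lemma lower_end_in_closure_I: "j \<in> V \<Longrightarrow> (ab j, yb j) \<in> closure I"
  using closure_mono[OF vsegment_subset_I] yb_less_yt by (force simp: closure_Times)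

lemma I_subset_closure_A: "I \<subseteq> closure A"
proof -
  have "(- ab ` V) \<times> (- ht ` H) \<subseteq> - L" unfolding L_def by auto
  moreover have "closure ((- ab ` V) \<times> (- ht ` H)) = UNIV"
    using finite_H finite_V by (simp add: closure_Times closure_complement empty_interior_finite)
  ultimately have "closure (- L) = UNIV" using closure_mono by blast
  then have "I \<subseteq> closure (- L \<inter> I)" using in_closure_Int_open[of _ "- L" I] open_I by blast
  then show ?thesis by (simp add: Diff_eq Int_commute)
qed

lemma eventually_on_lines_through:
  "\<forall>\<^sub>F z in nhds w. (\<forall>k\<in>H. z \<in> hline k \<longrightarrow> w \<in> hline k) \<and> (\<forall>j\<in>V. z \<in> vline j \<longrightarrow> w \<in> vline j)"
  by (intro eventually_conj eventually_ball_finite finite_H finite_V ballI eventually_mem_closed_imp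
      closed_Times closed_hx closed_vy closed_singleton)

lemma hx_bounded_by_segment:
  assumes k: "k \<in> H" and x: "(x, ht k) \<in> I" "x \<notin> hx k"
  obtains j where "j \<in> V" "ab j \<in> hx k" "ht k \<in> {yb j<..<yt j}"
    "x < xl k \<Longrightarrow> hx k \<subseteq> {ab j..}" "xr k < x \<Longrightarrow> hx k \<subseteq> {..ab j}"
proof -
  obtain p where p: "xl k < p" "p < xr k" using dense xl_less_xr[OF k] by blast
  then have "p \<in> interior (hx k)" unfolding interior_hx_iff[OF k] using xl_in_hx xr_in_hx k by blast
  from interval_end[OF closed_hx[OF k] is_interval_hx[OF k] this x(2)]
  obtain a where a: "a \<in> hx k" "a \<notin> interior (hx k)" "a \<in> closed_segment p x"
    "x < p \<Longrightarrow> hx k \<subseteq> {a..}" "p < x \<Longrightarrow> hx k \<subseteq> {..a}" by blast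
  have "(p, ht k) \<in> I" using hsegment_subset_I[OF k] p by auto
  then have "(a, ht k) \<in> I" using x(1) a(3) by (rule row_in_I)
  then obtain j where "j \<in> V" "ab j = a" "ht k \<in> {yb j<..<yt j}" using hx_ends_on_segment k a by blast
  then show ?thesis using that[of j] a p by auto
qed

lemma vy_bounded_by_hx:
  assumes j: "j \<in> V" and y: "(ab j, y) \<in> I" "y \<notin> vy j"
  obtains k where "k \<in> H" "ht k \<in> vy j" "ab j \<in> interior (hx k)" "(ab j, ht k) \<in> I"
    "y < yb j \<Longrightarrow> vy j \<subseteq> {ht k..}" "yt j < y \<Longrightarrow> vy j \<subseteq> {..ht k}"
proof -
  obtain p where p: "yb j < p" "p < yt j" using dense yb_less_yt[OF j] by blast
  then have "p \<in> interior (vy j)" unfolding interior_vy_iff[OF j] using yb_in_vy yt_in_vy j by blast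
  from interval_end[OF closed_vy[OF j] is_interval_vy[OF j] this y(2)]
  obtain a where a: "a \<in> vy j" "a \<notin> interior (vy j)" "a \<in> closed_segment p y"
    "y < p \<Longrightarrow> vy j \<subseteq> {a..}" "p < y \<Longrightarrow> vy j \<subseteq> {..a}" by blast
  have "(ab j, p) \<in> I" using vsegment_subset_I[OF j] p by auto
  then have aI: "(ab j, a) \<in> I" using y(1) a(3) by (rule column_in_I)
  then obtain k where "k \<in> H" "ht k = a" "ab j \<in> interior (hx k)" using vy_ends_on_hx j a by blast
  then show ?thesis using that[of k] a aI p by auto
qed

lemma eventually_hx_near_xl:
  assumes k: "k \<in> H"
  shows "\<forall>\<^sub>F x in nhds (xl k). (x, ht k) \<in> I \<longrightarrow> x \<in> hx k"
proof -
  have "xl k \<in> interior (hx k)" if "(xl k, ht k) \<in> I"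
    using hx_ends_on_segment[OF k xl_in_hx[OF k]] ab_neq_end[OF k] that by blast
  then show ?thesis
    using eventually_near_left_endpoint[of "{x. (x, ht k) \<in> I}" "xl k" "xr k" "hx k"]
      is_interval_row xl_less_xr[OF k] segment_subset_hx[OF k] hsegment_subset_I[OF k] by auto
qed

lemma eventually_vy_near_yb:
  assumes j: "j \<in> V"
  shows "\<forall>\<^sub>F y in nhds (yb j). (ab j, y) \<in> I \<longrightarrow> y \<in> vy j"
proof -
  have "yb j \<in> interior (vy j)" if "(ab j, yb j) \<in> I"
    using vy_ends_on_hx[OF j yb_in_vy[OF j]] ht_neq_end[OF _ j] that by blast
  then show ?thesis
    using eventually_near_left_endpoint[of "{y. (ab j, y) \<in> I}" "yb j" "yt j" "vy j"]
      is_interval_column yb_less_yt[OF j] segment_subset_vy[OF j] vsegment_subset_I[OF j] by auto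
qed

lemma eventually_L_near_left_end:
  assumes k: "k \<in> H"
  shows "\<forall>\<^sub>F z in nhds (xl k, ht k). z \<in> I \<longrightarrow> (z \<in> L \<longleftrightarrow> snd z = ht k)"
proof -
  have "\<forall>\<^sub>F z in nhds (xl k, ht k). (fst z, ht k) \<in> I \<longrightarrow> fst z \<in> hx k"
    using tendsto_fst[OF filterlim_ident, of "(xl k, ht k)"]
    by (intro eventually_compose_filterlim[OF eventually_hx_near_xl[OF k]]) simp
  with eventually_on_lines_through[of "(xl k, ht k)"] show ?thesis
  proof eventually_elim
    case (elim z)
    have "snd z = ht k" if "z \<in> L"
      using that
    proof (cases rule: L_cases)
      case (vertical j)
      then have "ab j = xl k" using elim by auto
      then show ?thesis using ab_neq_end[OF k vertical(1)] by blast
    qed (use elim in auto)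
    moreover have "z \<in> L" if "z \<in> I" "snd z = ht k"
      using that elim k unfolding L_def by (cases z) auto
    ultimately show ?case by blast
  qed
qed

lemma eventually_L_near_lower_end:
  assumes j: "j \<in> V"
  shows "\<forall>\<^sub>F z in nhds (ab j, yb j). z \<in> I \<longrightarrow> (z \<in> L \<longleftrightarrow> fst z = ab j)"
proof -
  have "\<forall>\<^sub>F z in nhds (ab j, yb j). (ab j, snd z) \<in> I \<longrightarrow> snd z \<in> vy j"
    using tendsto_snd[OF filterlim_ident, of "(ab j, yb j)"]
    by (intro eventually_compose_filterlim[OF eventually_vy_near_yb[OF j]]) simp
  with eventually_on_lines_through[of "(ab j, yb j)"] show ?thesis
  proof eventually_elim
    case (elim z)
    have "fst z = ab j" if "z \<in> L"
      using that
    proof (cases rule: L_cases)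
      case (horizontal k)
      then have "ht k = yb j" using elim by auto
      then show ?thesis using ht_neq_end[OF horizontal(1) j] by blast
    qed (use elim in auto)
    moreover have "z \<in> L" if "z \<in> I" "fst z = ab j"
      using that elim j unfolding L_def by (cases z) auto
    ultimately show ?case by blast
  qed
qed

lemma marked_two_sided:
  assumes "s \<in> marked"
  shows "two_sided_at A s"
  using assms
proof (cases rule: marked_cases)
  case (left k)
  then show ?thesis
    using two_sided_at_hyperplane[OF linear_snd convex_I, of L s] eventually_L_near_left_end by simp
next
  case (lower j)
  then show ?thesis
    using two_sided_at_hyperplane[OF linear_fst convex_I, of L s] eventually_L_near_lower_end by simp
qed

end

section \<open>Cuts along the paths leaving a marked endpoint\<close>

definition upper_half :: "real \<Rightarrow> point set" where
  "upper_half y = {z. y < snd z}"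

lemma mem_upper_half [simp]: "z \<in> upper_half y \<longleftrightarrow> y < snd z"
  by (simp add: upper_half_def)

lemma open_upper_half: "open (upper_half y)"
  unfolding upper_half_def by (intro open_Collect_less continuous_intros)

lemma closure_fst_greater: "closure {z::point. a < fst z} = {z. a \<le> fst z}"
  and closure_fst_less: "closure {z::point. fst z < a} = {z. fst z \<le> a}"
  and closure_snd_greater: "closure {z::point. a < snd z} = {z. a \<le> snd z}"
  and closure_snd_less: "closure {z::point. snd z < a} = {z. snd z \<le> a}"
proof -
  have "{z::point. a < fst z} = {a<..} \<times> UNIV" "{z::point. fst z < a} = {..<a} \<times> UNIV"
    "{z::point. a < snd z} = UNIV \<times> {a<..}" "{z::point. snd z < a} = UNIV \<times> {..<a}" by auto
  then show "closure {z::point. a < fst z} = {z. a \<le> fst z}"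
    "closure {z::point. fst z < a} = {z. fst z \<le> a}"
    "closure {z::point. a < snd z} = {z. a \<le> snd z}" "closure {z::point. snd z < a} = {z. snd z \<le> a}"
    by (auto simp: closure_Times)
qed

lemma not_in_closure_if_le: "w \<notin> closure U"
  if "continuous_on UNIV f" "\<And>z. z \<in> U \<Longrightarrow> f z \<le> c" "c < f w" for f :: "'a::topological_space \<Rightarrow> real"
  using that closure_minimal[of U "{z. f z \<le> c}"] closed_Collect_le[of f "\<lambda>_. c"] by fastforce

lemma not_in_closure_if_ge: "w \<notin> closure U"
  if "continuous_on UNIV f" "\<And>z. z \<in> U \<Longrightarrow> c \<le> f z" "f w < c" for f :: "'a::topological_space \<Rightarrow> real"
  using that closure_minimal[of U "{z. c \<le> f z}"] closed_Collect_le[of "\<lambda>_. c" f] by fastforce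

lemma not_in_closure_subset_upper_half: "U \<subseteq> upper_half y \<Longrightarrow> snd w < y \<Longrightarrow> w \<notin> closure U"
  by (rule not_in_closure_if_ge[of snd]) (auto intro: continuous_intros less_imp_le)

lemma not_in_frontierI: "w \<notin> closure U \<or> w \<notin> closure (- U) \<Longrightarrow> w \<notin> frontier U"
  unfolding frontier_closures by blast

lemma not_in_frontier_Int_open: "open Z \<Longrightarrow> w \<in> Z \<Longrightarrow> w \<notin> frontier U \<Longrightarrow> w \<notin> frontier (U \<inter> Z)"
  using frontier_Int_subset[of U Z] frontier_disjoint_eq[of Z] by blast

text \<open>Cut every extended segment at its marked endpoint and orient both pieces away from it. The sets \<open>U\<close>
  considered here lie above height \<open>y\<close> and to the right of a path that starts at this height between \<open>N\<close>
  and \<open>P\<close>, follows the orientation, and at its end on another extended segment continues with that one.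
  Such a path avoids the points off the segments and the marked endpoints, which are the elements of
  \<open>E\<close>.\<close>

definition path_cut :: "point set \<Rightarrow> real \<Rightarrow> real set \<Rightarrow> real set \<Rightarrow> point set \<Rightarrow> bool" where
  "path_cut E y N P U \<longleftrightarrow> U \<subseteq> upper_half y \<and> (\<forall>w \<in> E \<inter> upper_half y. w \<notin> frontier U) \<and>
     (\<forall>x\<in>N. (x, y) \<notin> closure U) \<and> (\<forall>x\<in>P. (x, y) \<notin> closure (upper_half y - U))"

abbreviation weak_path_cut :: "point set \<Rightarrow> real \<Rightarrow> real \<Rightarrow> point set \<Rightarrow> bool" where
  "weak_path_cut E y a U \<equiv> path_cut E y {x. (x, y) \<in> E \<and> x < a} {x. (x, y) \<in> E \<and> a < x} U"

lemma path_cut_mono: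
  "path_cut E y N P U \<Longrightarrow> E' \<subseteq> E \<Longrightarrow> N' \<subseteq> N \<Longrightarrow> P' \<subseteq> P \<Longrightarrow> path_cut E' y N' P' U"
  unfolding path_cut_def by blast

lemma path_cut_subset: "path_cut E y N P U \<Longrightarrow> U \<subseteq> upper_half y"
  unfolding path_cut_def by blast

lemma path_cut_above: "path_cut E y N P U \<Longrightarrow> w \<in> E \<Longrightarrow> y < snd w \<Longrightarrow> w \<notin> frontier U"
  unfolding path_cut_def by auto

lemma path_cut_left: "path_cut E y N P U \<Longrightarrow> snd w = y \<Longrightarrow> fst w \<in> N \<Longrightarrow> w \<notin> closure U"
  unfolding path_cut_def by (cases w) auto

lemma path_cut_right: "path_cut E y N P U \<Longrightarrow> snd w = y \<Longrightarrow> fst w \<in> P \<Longrightarrow> w \<notin> closure (upper_half y - U)"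
  unfolding path_cut_def by (cases w) auto

lemma not_in_frontier_sym_diff:
  assumes cuts: "path_cut E y N P U" "path_cut E y N P W"
    and w: "w \<in> E" "snd w = y \<Longrightarrow> fst w \<in> N \<union> P"
  shows "w \<notin> frontier (sym_diff U W)"
proof -
  have sub: "U \<subseteq> upper_half y" "W \<subseteq> upper_half y" using cuts by (blast dest: path_cut_subset)+
  consider "snd w < y" | "snd w = y" "fst w \<in> N" | "snd w = y" "fst w \<in> P" | "y < snd w"
    using w(2) by force
  then show ?thesis
  proof cases
    case 1
    have "sym_diff U W \<subseteq> upper_half y" using sub by blast
    then show ?thesis using not_in_closure_subset_upper_half 1 not_in_frontierI by blast
  next
    case 2
    then have "w \<notin> closure (U \<union> W)" using cuts path_cut_left unfolding closure_Un by blast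
    then show ?thesis using closure_mono[of "sym_diff U W" "U \<union> W"] not_in_frontierI by blast
  next
    case 3
    then have "w \<notin> closure ((upper_half y - U) \<union> (upper_half y - W))"
      using cuts path_cut_right unfolding closure_Un by blast
    moreover have "sym_diff U W \<subseteq> (upper_half y - U) \<union> (upper_half y - W)" using sub by blast
    ultimately show ?thesis using closure_mono not_in_frontierI by blast
  next
    case 4
    then have "w \<notin> frontier U" "w \<notin> frontier W" using cuts w(1) path_cut_above by blast+
    then show ?thesis using frontier_sym_diff_subset by blast
  qed
qed

text \<open>Prepends the vertical piece at abscissa \<open>a\<close> below height \<open>t\<close> to the path.\<close>

definition extend_down :: "real \<Rightarrow> real \<Rightarrow> point set \<Rightarrow> point set" where
  "extend_down a t U = {z. snd z \<le> t \<and> a < fst z} \<union> U"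

lemma extend_down_left:
  assumes cut: "path_cut E t N P U" and w: "snd w \<le> t" "fst w < a" "snd w = t \<Longrightarrow> fst w \<in> N"
  shows "w \<notin> closure (extend_down a t U)"
proof -
  have "w \<notin> closure U"
  proof (cases "snd w = t")
    case True
    then show ?thesis using path_cut_left[OF cut] w(3) by blast
  qed (use not_in_closure_subset_upper_half[OF path_cut_subset[OF cut]] w(1) in auto)
  moreover have "w \<notin> closure {z. snd z \<le> t \<and> a < fst z}"
    using w(2) by (intro not_in_closure_if_ge[of fst]) (auto intro: continuous_intros)
  ultimately show ?thesis unfolding extend_down_def closure_Un by blast
qed

lemma extend_down_right:
  assumes cut: "path_cut E t N P U" and w: "snd w \<le> t" "a < fst w" "snd w = t \<Longrightarrow> fst w \<in> P"
  shows "w \<notin> closure (- extend_down a t U)"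
proof -
  have "w \<notin> closure (upper_half t - U)"
  proof (cases "snd w = t")
    case True
    then show ?thesis using path_cut_right[OF cut] w(3) by blast
  qed (use not_in_closure_subset_upper_half[of "upper_half t - U" t w] w(1) in auto)
  moreover have "w \<notin> closure {z. fst z \<le> a}"
    using w(2) by (intro not_in_closure_if_le[of fst]) (auto intro: continuous_intros)
  moreover have "- extend_down a t U \<subseteq> (upper_half t - U) \<union> {z. fst z \<le> a}"
    unfolding extend_down_def by auto
  ultimately show ?thesis
    using closure_mono[of "- extend_down a t U" "(upper_half t - U) \<union> {z. fst z \<le> a}"]
    unfolding closure_Un by blast
qed

lemma extend_down_not_frontier:
  assumes cut: "weak_path_cut E t a U"
    and w: "w \<in> E" "snd w \<le> t \<Longrightarrow> fst w \<noteq> a"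
  shows "w \<notin> frontier (extend_down a t U)"
proof -
  consider "t < snd w" | "snd w \<le> t" "fst w < a" | "snd w \<le> t" "a < fst w"
    using w(2) by linarith
  then show ?thesis
  proof cases
    case 1
    have "w \<notin> closure {z. snd z \<le> t \<and> a < fst z}"
      using 1 by (intro not_in_closure_if_le[of snd]) (auto intro: continuous_intros)
    then have "w \<notin> frontier {z. snd z \<le> t \<and> a < fst z}" by (simp add: not_in_frontierI)
    then show ?thesis
      unfolding extend_down_def using frontier_Un_subset path_cut_above[OF cut w(1) 1] by blast
  next
    case 2
    have "fst w \<in> {x. (x, t) \<in> E \<and> x < a}" if "snd w = t" using that w(1) 2 by (cases w) auto
    then show ?thesis using extend_down_left[OF cut 2] not_in_frontierI by blast
  next
    case 3
    have "fst w \<in> {x. (x, t) \<in> E \<and> a < x}" if "snd w = t" using that w(1) 3 by (cases w) auto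
    then show ?thesis using extend_down_right[OF cut 3] not_in_frontierI by blast
  qed
qed

lemma path_cut_extend_down:
  assumes cut: "weak_path_cut E t a U"
    and y: "y < t" and column: "\<And>w. w \<in> E \<Longrightarrow> y < snd w \<Longrightarrow> snd w \<le> t \<Longrightarrow> fst w \<noteq> a"
  shows "path_cut E y {..<a} {a<..} (extend_down a t U \<inter> upper_half y)"
proof -
  let ?R = "extend_down a t U"
  have "w \<notin> frontier (?R \<inter> upper_half y)" if "w \<in> E \<inter> upper_half y" for w
    using that extend_down_not_frontier[OF cut] column
    by (intro not_in_frontier_Int_open[OF open_upper_half]) auto
  moreover have "(x, y) \<notin> closure (?R \<inter> upper_half y)" if "x < a" for x
    using extend_down_left[OF cut, of "(x, y)" a] that y closure_mono[of "?R \<inter> upper_half y" ?R] by auto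
  moreover have "(x, y) \<notin> closure (upper_half y - ?R \<inter> upper_half y)" if "a < x" for x
    using extend_down_right[OF cut, of "(x, y)" a] that y
      closure_mono[of "upper_half y - ?R \<inter> upper_half y" "- ?R"] by auto
  ultimately show ?thesis unfolding path_cut_def by blast
qed

context extended_segments
begin

lemma off_hx_on_row:
  assumes "w \<in> A \<union> marked" "k \<in> H" "snd w = ht k" "fst w \<noteq> xl k"
  shows "w \<in> I" "fst w \<notin> hx k"
proof -
  have "w \<notin> marked"
    using assms(2-4) unfolding marked_def by (auto simp: ht_eq_iff dest: ht_neq_end)
  then show "w \<in> I" "fst w \<notin> hx k" using assms unfolding L_def by (cases w; auto)+
qed

lemma off_vy_on_column:
  assumes "w \<in> A \<union> marked" "j \<in> V" "fst w = ab j" "snd w \<noteq> yb j"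
  shows "w \<in> I" "snd w \<notin> vy j"
proof -
  have "w \<notin> marked"
    using assms(2-4) unfolding marked_def by (auto simp: ab_eq_iff dest: ab_neq_end)
  then show "w \<in> I" "snd w \<notin> vy j" using assms unfolding L_def by (cases w; auto)+
qed

definition left_of_hx :: "'i \<Rightarrow> real set" where
  "left_of_hx k = {x. (x, ht k) \<in> I \<and> (\<forall>q\<in>hx k. x < q)}"

definition right_of_hx :: "'i \<Rightarrow> real set" where
  "right_of_hx k = {x. (x, ht k) \<in> I \<and> (\<forall>q\<in>hx k. q < x)}"

lemma beside_hx:
  assumes w: "w \<in> A \<union> marked" "w \<noteq> (xl k, ht k)" and k: "k \<in> H" "snd w = ht k"
  shows "fst w \<in> left_of_hx k \<union> right_of_hx k"
proof -
  have "fst w \<noteq> xl k" using w(2) k(2) by (simp add: prod_eq_iff)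
  then have I: "w \<in> I" "fst w \<notin> hx k" using off_hx_on_row[OF w(1) k] by auto
  then have "(\<forall>q\<in>hx k. fst w < q) \<or> (\<forall>q\<in>hx k. q < fst w)"
    using mem_is_interval_1_I[OF is_interval_hx[OF k(1)]] by (meson linorder_not_le order_less_imp_le)
  then show ?thesis using I(1) k(2) unfolding left_of_hx_def right_of_hx_def by (cases w) auto
qed

lemma left_path_cut_exists:
  assumes k: "k \<in> H"
    and up: "\<And>j. j \<in> V \<Longrightarrow> ht k \<in> {yb j<..<yt j} \<Longrightarrow> \<exists>U. path_cut (A \<union> marked) (ht k) {..<ab j} {ab j<..} U"
  shows "\<exists>U. path_cut (A \<union> marked) (ht k) (left_of_hx k) {x. \<exists>q\<in>hx k. q < x} U"
proof (cases "left_of_hx k = {}")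
  case True
  have "path_cut (A \<union> marked) (ht k) {} {x. \<exists>q\<in>hx k. q < x} (upper_half (ht k))"
    unfolding path_cut_def using frontier_disjoint_eq[of "upper_half (ht k)"] open_upper_half by auto
  then show ?thesis unfolding True ..
next
  case False
  then obtain x where x: "(x, ht k) \<in> I" "x < xl k" "x \<notin> hx k"
    using xl_in_hx[OF k] unfolding left_of_hx_def by auto
  from hx_bounded_by_segment[OF k x(1,3)] obtain j where j: "j \<in> V" "ab j \<in> hx k" "ht k \<in> {yb j<..<yt j}"
    "hx k \<subseteq> {ab j..}" using x(2) by metis
  obtain U where U: "path_cut (A \<union> marked) (ht k) {..<ab j} {ab j<..} U" using up j by blast
  have "left_of_hx k \<subseteq> {..<ab j}" "{x. \<exists>q\<in>hx k. q < x} \<subseteq> {ab j<..}"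
    using j unfolding left_of_hx_def by force+
  then show ?thesis using path_cut_mono[OF U order_refl] by blast
qed

lemma right_path_cut_exists:
  assumes k: "k \<in> H"
    and up: "\<And>j. j \<in> V \<Longrightarrow> ht k \<in> {yb j<..<yt j} \<Longrightarrow> \<exists>U. path_cut (A \<union> marked) (ht k) {..<ab j} {ab j<..} U"
  shows "\<exists>U. path_cut (A \<union> marked) (ht k) {x. \<exists>q\<in>hx k. x < q} (right_of_hx k) U"
proof (cases "right_of_hx k = {}")
  case True
  have "path_cut (A \<union> marked) (ht k) {x. \<exists>q\<in>hx k. x < q} {} {}" unfolding path_cut_def by auto
  then show ?thesis unfolding True ..
next
  case False
  then obtain x where x: "(x, ht k) \<in> I" "xr k < x" "x \<notin> hx k"
    using xr_in_hx[OF k] unfolding right_of_hx_def by auto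
  from hx_bounded_by_segment[OF k x(1,3)] obtain j where j: "j \<in> V" "ab j \<in> hx k" "ht k \<in> {yb j<..<yt j}"
    "hx k \<subseteq> {..ab j}" using x(2) by metis
  obtain U where U: "path_cut (A \<union> marked) (ht k) {..<ab j} {ab j<..} U" using up j by blast
  have "right_of_hx k \<subseteq> {ab j<..}" "{x. \<exists>q\<in>hx k. x < q} \<subseteq> {..<ab j}"
    using j unfolding right_of_hx_def by force+
  then show ?thesis using path_cut_mono[OF U order_refl] by blast
qed

text \<open>A path that arrives at \<open>a\<close> on the extended segment \<open>k\<close> turns away from the marked endpoint of \<open>k\<close>.\<close>

lemma turning_path_cut_exists:
  assumes k: "k \<in> H" and a: "a \<in> hx k"
    and up: "\<And>j. j \<in> V \<Longrightarrow> ht k \<in> {yb j<..<yt j} \<Longrightarrow> \<exists>U. path_cut (A \<union> marked) (ht k) {..<ab j} {ab j<..} U"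
  shows "\<exists>U. weak_path_cut (A \<union> marked) (ht k) a U" (is "\<exists>U. path_cut _ _ ?N ?P U")
proof -
  have beside: "x \<in> left_of_hx k \<union> right_of_hx k" if "(x, ht k) \<in> A \<union> marked" "x \<noteq> xl k" for x
    using beside_hx[OF that(1) _ k] that(2) by simp
  show ?thesis
  proof (cases "a \<le> xl k")
    case True
    obtain U where U: "path_cut (A \<union> marked) (ht k) (left_of_hx k) {x. \<exists>q\<in>hx k. q < x} U"
      using left_path_cut_exists[OF k up] by blast
    have "x \<in> left_of_hx k" if "x \<in> ?N" for x
      using beside[of x] that a True unfolding right_of_hx_def by fastforce
    moreover have "?P \<subseteq> {x. \<exists>q\<in>hx k. q < x}" using a by blast
    ultimately show ?thesis using path_cut_mono[OF U order_refl] by blast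
  next
    case False
    obtain U where U: "path_cut (A \<union> marked) (ht k) {x. \<exists>q\<in>hx k. x < q} (right_of_hx k) U"
      using right_path_cut_exists[OF k up] by blast
    have "x \<in> right_of_hx k" if "x \<in> ?P" for x
      using beside[of x] that a False unfolding left_of_hx_def by fastforce
    moreover have "?N \<subseteq> {x. \<exists>q\<in>hx k. x < q}" using a by blast
    ultimately show ?thesis using path_cut_mono[OF U order_refl] by blast
  qed
qed

lemma straight_path_cut:
  assumes j: "j \<in> V" "yb j < y" "y < yt j" and top: "\<And>t. yt j < t \<Longrightarrow> (ab j, t) \<in> I \<Longrightarrow> t \<in> vy j"
  shows "path_cut (A \<union> marked) y {..<ab j} {ab j<..} ({z. ab j < fst z} \<inter> upper_half y)"
    (is "path_cut _ y _ _ (?U \<inter> _)")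
proof -
  have left: "w \<notin> closure ?U" if "fst w < ab j" for w
    using that by (intro not_in_closure_if_ge[of fst]) (auto intro: continuous_intros)
  have right: "w \<notin> closure (- ?U)" if "ab j < fst w" for w
    using that by (intro not_in_closure_if_le[of fst]) (auto intro: continuous_intros)
  have column: "fst w \<noteq> ab j" if w: "w \<in> A \<union> marked" "y < snd w" for w
  proof
    assume eq: "fst w = ab j"
    then have "w \<in> I" "snd w \<notin> vy j" using off_vy_on_column[OF w(1) j(1)] j(2) w(2) by auto
    moreover have "(ab j, snd w) \<in> I" using \<open>w \<in> I\<close> eq by (cases w) auto
    ultimately show False
      using top[of "snd w"] segment_subset_vy[OF j(1)] j(2) w(2)
      by (cases "snd w \<le> yt j") (auto simp: subset_iff)
  qed
  have "w \<notin> frontier (?U \<inter> upper_half y)" if "w \<in> (A \<union> marked) \<inter> upper_half y" for w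
  proof (rule not_in_frontier_Int_open[OF open_upper_half])
    have "fst w < ab j \<or> ab j < fst w" using column[of w] that by (simp add: neq_iff)
    then show "w \<notin> frontier ?U" using left right not_in_frontierI by blast
  qed (use that in simp)
  moreover have "(x, y) \<notin> closure (?U \<inter> upper_half y)" if "x < ab j" for x
    using left[of "(x, y)"] that closure_mono[of "?U \<inter> upper_half y" ?U] by auto
  moreover have "(x, y) \<notin> closure (upper_half y - ?U \<inter> upper_half y)" if "ab j < x" for x
    using right[of "(x, y)"] that closure_mono[of "upper_half y - ?U \<inter> upper_half y" "- ?U"] by auto
  ultimately show ?thesis unfolding path_cut_def by blast
qed

lemma up_path_cut_exists:
  assumes "j \<in> V" "yb j < y" "y < yt j"
  shows "\<exists>U. path_cut (A \<union> marked) y {..<ab j} {ab j<..} U"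
  using assms
proof (induction "card {k\<in>H. y < ht k}" arbitrary: j y rule: less_induct)
  case less
  note j = less.prems
  show ?case
  proof (cases "\<forall>t>yt j. (ab j, t) \<in> I \<longrightarrow> t \<in> vy j")
    case True
    then show ?thesis using straight_path_cut[OF j] by blast
  next
    case False
    then obtain t where t: "yt j < t" "(ab j, t) \<in> I" "t \<notin> vy j" by blast
    from vy_bounded_by_hx[OF j(1) t(2,3)] obtain k where k: "k \<in> H" "ht k \<in> vy j" "ab j \<in> interior (hx k)"
      "vy j \<subseteq> {..ht k}" using t(1) by metis
    then have "y < ht k" using yt_in_vy[OF j(1)] j(3) by force
    then have "card {k'\<in>H. ht k < ht k'} < card {k'\<in>H. y < ht k'}"
      using finite_H k(1) by (intro psubset_card_mono) auto
    then have "\<exists>U. path_cut (A \<union> marked) (ht k) {..<ab j'} {ab j'<..} U"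
      if "j' \<in> V" "ht k \<in> {yb j'<..<yt j'}" for j'
      using less.hyps that by simp
    then obtain W where
      "weak_path_cut (A \<union> marked) (ht k) (ab j) W"
      using turning_path_cut_exists[OF k(1), of "ab j"] k(3) interior_subset by blast
    moreover have "fst w \<noteq> ab j" if w: "w \<in> A \<union> marked" "y < snd w" "snd w \<le> ht k" for w
    proof
      assume "fst w = ab j"
      then have "snd w \<notin> vy j" using off_vy_on_column[OF w(1) j(1)] j(2) w(2) by auto
      then show False
        using mem_is_interval_1_I[OF is_interval_vy[OF j(1)] yb_in_vy[OF j(1)] k(2)] j(2) w(2,3) by auto
    qed
    ultimately show ?thesis using path_cut_extend_down \<open>y < ht k\<close> by blast
  qed
qed

lemma jump_setI:
  assumes w: "w \<in> I" and Z: "open Z" "w \<in> closure Z" "w \<notin> closure (Z - U)"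
    and Z': "open Z'" "w \<in> closure Z'" "w \<notin> closure (Z' \<inter> U)"
  shows "w \<in> jump_set A U"
proof -
  have dense: "w \<in> closure (A \<inter> B)" if B: "open B" "w \<in> closure B" for B
  proof -
    have "w \<in> closure (B \<inter> I)" using B w open_I by (intro in_closure_Int_open)
    also have "\<dots> \<subseteq> closure (A \<inter> B)"
      using open_Int_closure_subset[OF B(1), of A] I_subset_closure_A
      by (intro closure_minimal closed_closure) (auto simp: Int_commute)
    finally show ?thesis .
  qed
  have "w \<in> closure ((A \<inter> U) \<union> (Z - U))"
    using dense[OF Z(1,2)] closure_mono[of "A \<inter> Z" "(A \<inter> U) \<union> (Z - U)"] by blast
  moreover have "w \<in> closure ((A - U) \<union> (Z' \<inter> U))"
    using dense[OF Z'(1,2)] closure_mono[of "A \<inter> Z'" "(A - U) \<union> (Z' \<inter> U)"] by blast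
  ultimately show ?thesis using Z(3) Z'(3) unfolding jump_set_def closure_Un by blast
qed

lemma jump_at_left_end:
  assumes k: "k \<in> H"
  shows "\<exists>U. jump_set A U \<inter> (A \<union> marked) = {(xl k, ht k)}"
proof -
  obtain W where W: "path_cut (A \<union> marked) (ht k) (left_of_hx k) {x. \<exists>q\<in>hx k. q < x} W"
    using left_path_cut_exists[OF k] up_path_cut_exists by auto
  obtain R where R: "path_cut (A \<union> marked) (ht k) {x. \<exists>q\<in>hx k. x < q} (right_of_hx k) R"
    using right_path_cut_exists[OF k] up_path_cut_exists by auto
  let ?U = "sym_diff W R"
  have "left_of_hx k \<subseteq> {x. \<exists>q\<in>hx k. x < q}" "right_of_hx k \<subseteq> {x. \<exists>q\<in>hx k. q < x}"
    using xl_in_hx[OF k] unfolding left_of_hx_def right_of_hx_def by auto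
  then have cuts: "path_cut (A \<union> marked) (ht k) (left_of_hx k) (right_of_hx k) W"
    "path_cut (A \<union> marked) (ht k) (left_of_hx k) (right_of_hx k) R"
    using path_cut_mono[OF W] path_cut_mono[OF R] by blast+
  have "w \<notin> jump_set A ?U" if w: "w \<in> A \<union> marked" "w \<noteq> (xl k, ht k)" for w
    using not_in_frontier_sym_diff[OF cuts w(1)] beside_hx[OF w k] jump_set_subset_frontier by blast
  moreover have "(xl k, ht k) \<in> jump_set A ?U"
  proof -
    have "(x, ht k) \<in> jump_set A ?U" if x: "xl k < x" "x < xr k" for x
    proof (rule jump_setI[where Z = "upper_half (ht k)" and Z' = "{z. snd z < ht k}"])
      show "(x, ht k) \<in> I" using hsegment_subset_I[OF k] x by auto
      have "(x, ht k) \<notin> closure ((upper_half (ht k) - W) \<union> R)"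
        using path_cut_right[OF W, of "(x, ht k)"] path_cut_left[OF R, of "(x, ht k)"]
          xl_in_hx[OF k] xr_in_hx[OF k] x unfolding closure_Un by auto
      then show "(x, ht k) \<notin> closure (upper_half (ht k) - ?U)"
        using closure_mono[of "upper_half (ht k) - ?U" "(upper_half (ht k) - W) \<union> R"] by blast
      have "{z. snd z < ht k} \<inter> ?U = {}"
        using path_cut_subset[OF W] path_cut_subset[OF R] by fastforce
      then show "(x, ht k) \<notin> closure ({z. snd z < ht k} \<inter> ?U)" by simp
    qed (auto simp: upper_half_def closure_snd_greater closure_snd_less
      intro!: open_Collect_less continuous_intros)
    then have "{xl k<..<xr k} \<times> {ht k} \<subseteq> jump_set A ?U" by auto
    then have "closure ({xl k<..<xr k} \<times> {ht k}) \<subseteq> jump_set A ?U"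
      by (rule closure_minimal[OF _ closed_jump_set])
    then show ?thesis using xl_less_xr[OF k] by (auto simp: closure_Times subset_iff)
  qed
  moreover have "(xl k, ht k) \<in> marked" using k unfolding marked_def by blast
  ultimately show ?thesis by blast
qed

lemma lower_end_in_jump_set:
  assumes j: "j \<in> V" and m: "yb j < m" "m < yt j" and U: "U \<subseteq> upper_half m"
  shows "(ab j, yb j) \<in> jump_set A (extend_down (ab j) m U)" (is "_ \<in> ?J")
proof -
  have "(ab j, y) \<in> ?J" if y: "yb j < y" "y < m" for y
  proof (rule jump_setI[where Z = "{z. ab j < fst z}" and Z' = "{z. fst z < ab j}"])
    show "(ab j, y) \<in> I" using vsegment_subset_I[OF j] y m by auto
    show "(ab j, y) \<notin> closure ({z. ab j < fst z} - extend_down (ab j) m U)"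
      "(ab j, y) \<notin> closure ({z. fst z < ab j} \<inter> extend_down (ab j) m U)"
      by (rule not_in_closure_subset_upper_half[of _ m]; use y(2) U in \<open>auto simp: extend_down_def\<close>)+
  qed (auto simp: closure_fst_greater closure_fst_less intro!: open_Collect_less continuous_intros)
  then have "{ab j} \<times> {yb j<..<m} \<subseteq> ?J" by auto
  then have "closure ({ab j} \<times> {yb j<..<m}) \<subseteq> ?J" by (rule closure_minimal[OF _ closed_jump_set])
  then show ?thesis using m(1) by (auto simp: closure_Times subset_iff)
qed

lemma below_lower_end:
  assumes j: "j \<in> V" and w: "w \<in> A \<union> marked" "w \<noteq> (ab j, yb j)" "fst w = ab j" "snd w < yt j"
  shows "snd w < yb j" "w \<in> I" "snd w \<notin> vy j"
proof -
  have "snd w \<noteq> yb j" using w by (auto simp: prod_eq_iff)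
  then show off: "w \<in> I" "snd w \<notin> vy j" using off_vy_on_column[OF w(1) j w(3)] by auto
  then show "snd w < yb j"
    using subsetD[OF segment_subset_vy[OF j], of "snd w"] w(4) by (cases "yb j \<le> snd w") auto
qed

text \<open>If the lower piece of \<open>j\<close> leaves \<open>I\<close>, the path upwards is continued downwards by the whole line.\<close>

lemma no_other_jump_if_lower_piece_unbounded:
  assumes j: "j \<in> V" and m: "yb j < m" "m < yt j" and W: "path_cut (A \<union> marked) m {..<ab j} {ab j<..} W"
    and unbounded: "\<And>y. y < yb j \<Longrightarrow> (ab j, y) \<in> I \<Longrightarrow> y \<in> vy j"
    and w: "w \<in> A \<union> marked - {(ab j, yb j)}"
  shows "w \<notin> jump_set A (extend_down (ab j) m W)"
proof -
  have "fst w \<noteq> ab j" if "snd w \<le> m"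
  proof
    assume "fst w = ab j"
    then have "snd w < yb j" "w \<in> I" "snd w \<notin> vy j" using below_lower_end[OF j, of w] w that m(2) by auto
    then show False using unbounded[of "snd w"] \<open>fst w = ab j\<close> by (cases w) auto
  qed
  moreover have "weak_path_cut (A \<union> marked - {(ab j, yb j)}) m (ab j) W"
    by (rule path_cut_mono[OF W]) auto
  ultimately show ?thesis using extend_down_not_frontier w jump_set_subset_frontier by blast
qed

text \<open>If the lower piece of \<open>j\<close> ends on the extended segment \<open>k\<close>, the two paths from the marked endpoint
  are separated by the symmetric difference with a cut along the path continuing with \<open>k\<close>. The latter has
  no jump at the marked endpoint.\<close>

lemma no_other_jump_if_lower_piece_bounded:
  assumes j: "j \<in> V" and m: "yb j < m" "m < yt j" and W: "path_cut (A \<union> marked) m {..<ab j} {ab j<..} W"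
    and k: "k \<in> H" "ht k \<in> vy j" "ht k < yb j" "ab j \<in> hx k"
    and Q: "weak_path_cut (A \<union> marked) (ht k) (ab j) Q"
    and w: "w \<in> A \<union> marked - {(ab j, yb j)}"
  shows "w \<notin> jump_set A (sym_diff (extend_down (ab j) m W \<inter> upper_half (ht k)) Q)"
proof -
  let ?E = "A \<union> marked - {(ab j, yb j)}" and ?R = "extend_down (ab j) m W \<inter> upper_half (ht k)"
  have "weak_path_cut ?E m (ab j) W" by (rule path_cut_mono[OF W]) auto
  then have "path_cut ?E (ht k) {..<ab j} {ab j<..} ?R"
  proof (rule path_cut_extend_down)
    show "fst z \<noteq> ab j" if z: "z \<in> ?E" "ht k < snd z" "snd z \<le> m" for z
      using below_lower_end[OF j, of z] z m(2)
        mem_is_interval_1_I[OF is_interval_vy[OF j] k(2) yb_in_vy[OF j], of "snd z"] by auto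
  qed (use k(3) m in simp)
  then have R: "weak_path_cut ?E (ht k) (ab j) ?R" by (rule path_cut_mono[OF _ order_refl]) auto
  have Q': "weak_path_cut ?E (ht k) (ab j) Q" by (rule path_cut_mono[OF Q]) auto
  have "fst w \<noteq> ab j" if row: "snd w = ht k"
    using off_hx_on_row[of w k] w k row ab_neq_end[OF k(1) j] by auto
  then have "w \<notin> frontier (sym_diff ?R Q)"
    using w by (intro not_in_frontier_sym_diff[OF R Q' w]) (cases w, auto)
  then show ?thesis using jump_set_subset_frontier by blast
qed

lemma jump_at_lower_end:
  assumes j: "j \<in> V"
  shows "\<exists>U. jump_set A U \<inter> (A \<union> marked) = {(ab j, yb j)}"
proof -
  let ?s = "(ab j, yb j)"
  obtain m where m: "yb j < m" "m < yt j" using dense yb_less_yt[OF j] by blast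
  obtain W where W: "path_cut (A \<union> marked) m {..<ab j} {ab j<..} W"
    using up_path_cut_exists[OF j m] by blast
  have s: "?s \<in> marked" using j unfolding marked_def by blast
  have jump: "?s \<in> jump_set A (extend_down (ab j) m W)"
    using lower_end_in_jump_set[OF j m path_cut_subset[OF W]] .
  show ?thesis
  proof (cases "\<forall>y<yb j. (ab j, y) \<in> I \<longrightarrow> y \<in> vy j")
    case True
    then show ?thesis using jump s no_other_jump_if_lower_piece_unbounded[OF j m W] by blast
  next
    case False
    then obtain y where y: "y < yb j" "(ab j, y) \<in> I" "y \<notin> vy j" by blast
    from vy_bounded_by_hx[OF j y(2,3)] obtain k where k: "k \<in> H" "ht k \<in> vy j" "ab j \<in> interior (hx k)"
      "vy j \<subseteq> {ht k..}" using y(1) by metis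
    have t: "ht k < yb j" using k(4) yb_in_vy[OF j] ht_neq_end[OF k(1) j] by force
    have ab: "ab j \<in> hx k" using k(3) interior_subset by blast
    obtain Q where Q: "weak_path_cut (A \<union> marked) (ht k) (ab j) Q"
      using turning_path_cut_exists[OF k(1) ab] up_path_cut_exists by auto
    have "?s \<in> jump_set A (extend_down (ab j) m W \<inter> upper_half (ht k))"
      using jump open_upper_half by (rule jump_set_Int_open) (use t in simp)
    moreover have "?s \<notin> frontier Q" using path_cut_above[OF Q, of ?s] s t by simp
    ultimately have "?s \<in> jump_set A (sym_diff (extend_down (ab j) m W \<inter> upper_half (ht k)) Q)"
      by (rule jump_set_sym_diff)
    then show ?thesis using s no_other_jump_if_lower_piece_bounded[OF j m W k(1,2) t ab Q] by blast
  qed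
qed

lemma marked_single_jump: "s \<in> marked \<Longrightarrow> \<exists>U. jump_set A U \<inter> (A \<union> marked) = {s}"
  by (erule marked_cases) (simp_all only: jump_at_left_end jump_at_lower_end)

end

section \<open>Propagation of jumps\<close>

lemma connected_subset_open:
  assumes "connected X" "open Z" "s \<in> X \<inter> Z" "X \<inter> closure (X \<inter> Z) \<subseteq> Z"
  shows "X \<subseteq> Z"
proof -
  have "openin (top_of_set X) (X \<inter> Z)" using assms(2) by (rule openin_open_Int)
  moreover have "X \<inter> closure (X \<inter> Z) = X \<inter> Z" using assms(4) closure_subset[of "X \<inter> Z"] by blast
  then have "closedin (top_of_set X) (X \<inter> Z)" by (metis closed_closure closedin_closed_Int)
  ultimately have "X \<inter> Z = {} \<or> X \<inter> Z = X" using assms(1) unfolding connected_clopen by blast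
  then show ?thesis using assms(3) by blast
qed

lemma open_contains_square:
  fixes x y :: real
  assumes "open Z" "(x, y) \<in> Z"
  obtains e where "e > 0" "{x - e<..<x + e} \<times> {y - e<..<y + e} \<subseteq> Z"
proof -
  obtain X Y where XY: "open X" "open Y" "(x, y) \<in> X \<times> Y" "X \<times> Y \<subseteq> Z"
    using assms by (rule open_prod_elim)
  obtain d where d: "d > 0" "ball x d \<subseteq> X" using XY(1,3) by (auto elim: openE)
  obtain d' where d': "d' > 0" "ball y d' \<subseteq> Y" using XY(2,3) by (auto elim: openE)
  have "{x - min d d'<..<x + min d d'} \<subseteq> ball x d" "{y - min d d'<..<y + min d d'} \<subseteq> ball y d'"
    by (auto simp: dist_real_def)
  then have "{x - min d d'<..<x + min d d'} \<times> {y - min d d'<..<y + min d d'} \<subseteq> Z"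
    using d d' XY(4) by blast
  then show ?thesis using that[of "min d d'"] d(1) d'(1) by simp
qed

definition half_line :: "bool \<Rightarrow> real \<Rightarrow> real set" where
  "half_line b c = (if b then {c<..} else {..<c})"

definition horizontal_arm :: "bool \<Rightarrow> point \<Rightarrow> point set" where
  "horizontal_arm b w = half_line b (fst w) \<times> {snd w}"

definition vertical_arm :: "bool \<Rightarrow> point \<Rightarrow> point set" where
  "vertical_arm b w = {fst w} \<times> half_line b (snd w)"

lemma closure_half_line: "closure (half_line b c) = (if b then {c..} else {..c})"
  by (simp add: half_line_def)

lemma in_closure_arm: "w \<in> closure (horizontal_arm b w)" "w \<in> closure (vertical_arm b w)"
  by (cases w; simp add: horizontal_arm_def vertical_arm_def closure_Times closure_half_line)+

text \<open>The open quadrants of a square are linked through the points of the four arms of the cross at its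
  centre. Three arms suffice to link all of them.\<close>

locale cross_square =
  fixes A U :: "point set" and x y e :: real
  assumes no_jump: "A \<inter> jump_set A U = {}" and e: "e > 0"
    and off_cross: "u \<in> {x - e<..<x + e} \<Longrightarrow> v \<in> {y - e<..<y + e} \<Longrightarrow> u \<noteq> x \<Longrightarrow> v \<noteq> y \<Longrightarrow> (u, v) \<in> A"
begin

definition quadrant :: "bool \<Rightarrow> bool \<Rightarrow> point set" where
  "quadrant b d = (if b then {x<..<x + e} else {x - e<..<x}) \<times> (if d then {y<..<y + e} else {y - e<..<y})"

definition centre :: "bool \<Rightarrow> bool \<Rightarrow> point" where
  "centre b d = (if b then x + e / 2 else x - e / 2, if d then y + e / 2 else y - e / 2)"

lemma quadrant_subset: "quadrant b d \<subseteq> A"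
  using e by (auto simp: quadrant_def split: if_splits intro!: off_cross)

lemma centre_in_quadrant: "centre b d \<in> quadrant b d"
  using e by (auto simp: quadrant_def centre_def)

lemma closure_quadrant: "closure (quadrant b d) =
    (if b then {x..x + e} else {x - e..x}) \<times> (if d then {y..y + e} else {y - e..y})"
  using e by (simp add: quadrant_def closure_Times)

lemma connected_quadrant: "connected (quadrant b d)"
  unfolding quadrant_def by (intro convex_connected convex_Times) auto

lemma linked_quadrants:
  assumes z: "z \<in> closure (quadrant b d)" "z \<in> closure (quadrant b' d')" "z \<notin> jump_set A U"
    and p: "p \<in> A \<inter> insert z (quadrant b d)" and q: "q \<in> A \<inter> insert z (quadrant b' d')"
  shows "p \<in> U \<longleftrightarrow> q \<in> U"
proof (rule connected_disjoint_jump_set)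
  let ?Q = "insert z (quadrant b d) \<union> insert z (quadrant b' d')"
  have "connected (insert z (quadrant b d))" if "z \<in> closure (quadrant b d)" for b d
    using that closure_subset by (intro connected_intermediate_closure[OF connected_quadrant]) blast+
  then show "connected ?Q" using z(1,2) by (intro connected_Un) auto
  show "?Q \<subseteq> closure A"
    using z(1) quadrant_subset closure_subset[of A] closure_mono[OF quadrant_subset] by blast
  show "?Q \<inter> jump_set A U = {}" using z(3) no_jump quadrant_subset by blast
  show "p \<in> ?Q \<inter> A" "q \<in> ?Q \<inter> A" using p q by auto
qed

lemma arm_meets_square:
  assumes "(x, y) \<in> closure (B - J)"
  obtains u v where "(u, v) \<in> B" "(u, v) \<notin> J" "u \<in> {x - e<..<x + e}" "v \<in> {y - e<..<y + e}"
proof -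
  have "(x, y) \<in> closure ((B - J) \<inter> {x - e<..<x + e} \<times> {y - e<..<y + e})"
    using assms e by (intro in_closure_Int_open[of _ "B - J"] open_Times) auto
  then have "(B - J) \<inter> {x - e<..<x + e} \<times> {y - e<..<y + e} \<noteq> {}" by force
  then show ?thesis using that by blast
qed

lemma vertical_arm_links:
  assumes "(x, y) \<in> closure (vertical_arm d (x, y) - jump_set A U)"
  shows "centre True d \<in> U \<longleftrightarrow> centre False d \<in> U"
proof -
  obtain u v where z: "(u, v) \<in> vertical_arm d (x, y)" "(u, v) \<notin> jump_set A U" "v \<in> {y - e<..<y + e}"
    using assms by (rule arm_meets_square)
  have "(u, v) \<in> closure (quadrant b d)" for b
    using z(1,3) e unfolding closure_quadrant
      by (auto simp: vertical_arm_def half_line_def split: if_splits)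
  then show ?thesis
    using z(2) centre_in_quadrant quadrant_subset by (intro linked_quadrants) blast+
qed

lemma horizontal_arm_links:
  assumes "(x, y) \<in> closure (horizontal_arm b (x, y) - jump_set A U)"
  shows "centre b True \<in> U \<longleftrightarrow> centre b False \<in> U"
proof -
  obtain u v where z: "(u, v) \<in> horizontal_arm b (x, y)" "(u, v) \<notin> jump_set A U" "u \<in> {x - e<..<x + e}"
    using assms by (rule arm_meets_square)
  have "(u, v) \<in> closure (quadrant b d)" for d
    using z(1,3) e unfolding closure_quadrant
      by (auto simp: horizontal_arm_def half_line_def split: if_splits)
  then show ?thesis
    using z(2) centre_in_quadrant quadrant_subset by (intro linked_quadrants) blast+
qed

lemma no_jump_at_centre:
  assumes centres: "\<And>b d. centre b d \<in> U \<longleftrightarrow> centre True True \<in> U"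
  shows "(x, y) \<notin> jump_set A U"
proof -
  let ?Q = "{x - e<..<x + e} \<times> {y - e<..<y + e}"
  have agree: "z \<in> U \<longleftrightarrow> centre True True \<in> U" if z: "z \<in> A \<inter> ?Q" for z
  proof -
    have "z \<in> closure (quadrant (x \<le> fst z) (y \<le> snd z))"
      using z unfolding closure_quadrant by (cases z) auto
    then have "z \<in> U \<longleftrightarrow> centre (x \<le> fst z) (y \<le> snd z) \<in> U"
      using z no_jump centre_in_quadrant quadrant_subset by (intro linked_quadrants) blast+
    then show ?thesis using centres by blast
  qed
  have "open ?Q" "(x, y) \<in> ?Q" using e by (auto intro: open_Times)
  then have "(x, y) \<in> closure (A \<inter> U \<inter> ?Q)" "(x, y) \<in> closure ((A - U) \<inter> ?Q)"
    if "(x, y) \<in> jump_set A U"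
    using that in_closure_Int_open unfolding jump_set_def by blast+
  moreover have "A \<inter> U \<inter> ?Q = {} \<or> (A - U) \<inter> ?Q = {}" using agree by blast
  ultimately show ?thesis by (metis closure_empty empty_iff)
qed

lemma three_arms:
  assumes "(\<forall>b. (x, y) \<in> closure (horizontal_arm b (x, y) - jump_set A U)) \<and>
      (\<exists>b. (x, y) \<in> closure (vertical_arm b (x, y) - jump_set A U)) \<or>
    (\<forall>b. (x, y) \<in> closure (vertical_arm b (x, y) - jump_set A U)) \<and>
      (\<exists>b. (x, y) \<in> closure (horizontal_arm b (x, y) - jump_set A U))"
  shows "(x, y) \<notin> jump_set A U"
proof (rule no_jump_at_centre)
  fix b d
  consider (rows) a where "\<And>b. centre b True \<in> U \<longleftrightarrow> centre b False \<in> U"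
    "centre True a \<in> U \<longleftrightarrow> centre False a \<in> U"
    | (columns) a where "\<And>d. centre True d \<in> U \<longleftrightarrow> centre False d \<in> U"
      "centre a True \<in> U \<longleftrightarrow> centre a False \<in> U"
    using assms vertical_arm_links horizontal_arm_links by blast
  then show "centre b d \<in> U \<longleftrightarrow> centre True True \<in> U"
  proof cases
    case (rows a)
    then show ?thesis by (cases a; cases b; cases d) simp_all
  next
    case (columns a)
    then show ?thesis by (cases a; cases b; cases d) simp_all
  qed
qed

end

context extended_segments
begin

lemma cross_square_exists:
  assumes w: "(x, y) \<in> I" and U: "A \<inter> jump_set A U = {}"
  obtains e where "cross_square A U x y e"
proof -
  obtain Z where Z: "open Z" "(x, y) \<in> Z"
    "\<And>z k. z \<in> Z \<Longrightarrow> k \<in> H \<Longrightarrow> z \<in> hline k \<Longrightarrow> (x, y) \<in> hline k"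
    "\<And>z j. z \<in> Z \<Longrightarrow> j \<in> V \<Longrightarrow> z \<in> vline j \<Longrightarrow> (x, y) \<in> vline j"
    using eventually_on_lines_through[of "(x, y)"] unfolding eventually_nhds by metis
  obtain e where e: "e > 0" "{x - e<..<x + e} \<times> {y - e<..<y + e} \<subseteq> Z \<inter> I"
    using open_contains_square[of "Z \<inter> I" x y] Z(1,2) w open_I by auto
  have "cross_square A U x y e"
  proof
    fix u v assume uv: "u \<in> {x - e<..<x + e}" "v \<in> {y - e<..<y + e}" "u \<noteq> x" "v \<noteq> y"
    then have "(u, v) \<in> Z \<inter> I" using e(2) by blast
    moreover have "(u, v) \<notin> L"
    proof
      assume "(u, v) \<in> L"
      then show False
      proof (cases rule: L_cases)
        case (horizontal k)
        then show False using Z(3)[of "(u, v)" k] uv(4) \<open>(u, v) \<in> Z \<inter> I\<close> by auto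
      next
        case (vertical j)
        then show False using Z(4)[of "(u, v)" j] uv(3) \<open>(u, v) \<in> Z \<inter> I\<close> by auto
      qed
    qed
    ultimately show "(u, v) \<in> A" by blast
  qed (use U e(1) in auto)
  then show ?thesis by (rule that)
qed

context
  fixes U :: "point set"
  assumes off_jump: "A \<inter> jump_set A U = {}"
begin

abbreviation J :: "point set" where
  "J \<equiv> jump_set A U"

definition jump_free_row :: "'i \<Rightarrow> bool" where
  "jump_free_row k \<longleftrightarrow> (\<forall>x\<in>interior (hx k). (x, ht k) \<in> I \<longrightarrow> (x, ht k) \<notin> J)"

lemma three_arms_no_jump:
  assumes "w \<in> I"
    and "(\<forall>b. w \<in> closure (horizontal_arm b w - J)) \<and> (\<exists>b. w \<in> closure (vertical_arm b w - J)) \<or>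
      (\<forall>b. w \<in> closure (vertical_arm b w - J)) \<and> (\<exists>b. w \<in> closure (horizontal_arm b w - J))"
  shows "w \<notin> J"
proof -
  obtain x y where xy: "w = (x, y)" by (cases w)
  obtain e where "cross_square A U x y e" using cross_square_exists assms(1) off_jump unfolding xy by blast
  then show ?thesis using cross_square.three_arms[of A U x y e] assms(2) unfolding xy by blast
qed

lemma no_jump_along_segment:
  assumes s: "s \<notin> J"
    and step: "\<And>z. z \<in> closed_segment s w - {s} \<Longrightarrow> z \<in> closure (closed_segment s w - {z} - J) \<Longrightarrow> z \<notin> J"
  shows "w \<notin> J"
proof -
  have "closed_segment s w \<subseteq> - J"
  proof (rule connected_subset_open[of _ _ s])
    show "closed_segment s w \<inter> closure (closed_segment s w \<inter> - J) \<subseteq> - J"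
    proof
      fix z assume z: "z \<in> closed_segment s w \<inter> closure (closed_segment s w \<inter> - J)"
      show "z \<in> - J"
      proof
        assume "z \<in> J"
        then have "closed_segment s w \<inter> - J = closed_segment s w - {z} - J" by blast
        then have "z \<in> closure (closed_segment s w - {z} - J)" using z by (metis IntD2)
        then show False using step[of z] s z \<open>z \<in> J\<close> by blast
      qed
    qed
  qed (use s closed_jump_set in auto)
  then show ?thesis using ends_in_segment by blast
qed

lemma no_jump_along_column:
  assumes s: "s \<notin> J" and I: "closed_segment s w - {s} \<subseteq> I" and line: "fst s = fst w"
    and arms: "\<And>z b. z \<in> closed_segment s w - {s} \<Longrightarrow> z \<in> closure (horizontal_arm b z - J)"
  shows "w \<notin> J"
proof (rule no_jump_along_segment[OF s])
  fix z assume z: "z \<in> closed_segment s w - {s}" "z \<in> closure (closed_segment s w - {z} - J)"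
  have "closed_segment s w - {z} \<subseteq> vertical_arm True z \<union> vertical_arm False z"
    using z(1) line by (cases z) (auto simp: closed_segment_same_fst vertical_arm_def half_line_def)
  then have "closed_segment s w - {z} - J \<subseteq> (vertical_arm True z - J) \<union> (vertical_arm False z - J)" by blast
  from subsetD[OF closure_mono[OF this] z(2)]
  have "\<exists>b. z \<in> closure (vertical_arm b z - J)" unfolding closure_Un by blast
  then show "z \<notin> J" using three_arms_no_jump[of z] arms[OF z(1)] I z(1) by blast
qed

lemma no_jump_along_row:
  assumes s: "s \<notin> J" and I: "closed_segment s w - {s} \<subseteq> I" and line: "snd s = snd w"
    and arms: "\<And>z b. z \<in> closed_segment s w - {s} \<Longrightarrow> z \<in> closure (vertical_arm b z - J)"
  shows "w \<notin> J"
proof (rule no_jump_along_segment[OF s])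
  fix z assume z: "z \<in> closed_segment s w - {s}" "z \<in> closure (closed_segment s w - {z} - J)"
  have "closed_segment s w - {z} \<subseteq> horizontal_arm True z \<union> horizontal_arm False z"
    using z(1) line by (cases z) (auto simp: closed_segment_same_snd horizontal_arm_def half_line_def)
  then have "closed_segment s w - {z} - J \<subseteq> (horizontal_arm True z - J) \<union> (horizontal_arm False z - J)"
    by blast
  from subsetD[OF closure_mono[OF this] z(2)]
  have "\<exists>b. z \<in> closure (horizontal_arm b z - J)" unfolding closure_Un by blast
  then show "z \<notin> J" using three_arms_no_jump[of z] arms[OF z(1)] I z(1) by blast
qed

lemma arm_no_jump:
  assumes "w \<in> I" "w \<in> closure B" "eventually P (nhds w)"
    and "\<And>z. z \<in> B \<inter> I \<Longrightarrow> P z \<Longrightarrow> (\<forall>k\<in>H. z \<in> hline k \<longrightarrow> w \<in> hline k) \<Longrightarrow>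
      (\<forall>j\<in>V. z \<in> vline j \<longrightarrow> w \<in> vline j) \<Longrightarrow> z \<in> L \<Longrightarrow> z \<notin> J"
  shows "w \<in> closure (B - J)"
proof -
  have "\<forall>\<^sub>F z in nhds w. z \<in> I" using open_I assms(1) by (rule eventually_nhds_in_open)
  with eventually_on_lines_through[of w] assms(3) have "\<forall>\<^sub>F z in nhds w. z \<in> B \<longrightarrow> z \<in> - J"
    by eventually_elim (use assms(4) off_jump in blast)
  then show ?thesis using in_closure_Int_eventually[OF assms(2)] by (simp add: Diff_eq)
qed

lemma horizontal_arm_no_jump:
  assumes j: "j \<in> V" "(ab j, y) \<in> I"
    and rows: "\<And>k. k \<in> H \<Longrightarrow> ht k = y \<Longrightarrow> ab j \<in> hx k \<Longrightarrow> jump_free_row k"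
  shows "(ab j, y) \<in> closure (horizontal_arm b (ab j, y) - J)"
proof (rule arm_no_jump[OF j(2) in_closure_arm(1) eventually_True])
  fix z assume z: "z \<in> horizontal_arm b (ab j, y) \<inter> I"
    and through: "\<forall>k\<in>H. z \<in> hline k \<longrightarrow> (ab j, y) \<in> hline k"
    "\<forall>i\<in>V. z \<in> vline i \<longrightarrow> (ab j, y) \<in> vline i" and "z \<in> L"
  obtain x where x: "z = (x, y)" "x \<noteq> ab j"
    using z by (cases z) (auto simp: horizontal_arm_def half_line_def split: if_splits)
  have no_vline: "z \<notin> vline i" if "i \<in> V" for i using through(2) that x by auto
  from \<open>z \<in> L\<close> show "z \<notin> J"
  proof (cases rule: L_cases)
    case (horizontal k)
    have "x \<in> interior (hx k)"
    proof (rule ccontr)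
      assume "x \<notin> interior (hx k)"
      then obtain i where "i \<in> V" "ab i = x" "ht k \<in> {yb i<..<yt i}"
        using hx_ends_on_segment[OF horizontal(1), of x] horizontal(2) z x(1) by auto
      moreover from this have "y \<in> vy i" using segment_subset_vy[of i] horizontal(2) x(1) by auto
      ultimately show False using no_vline[of i] x(1) by auto
    qed
    moreover have "jump_free_row k" using rows[of k] through(1) horizontal by auto
    ultimately show ?thesis using horizontal(2) z x(1) unfolding jump_free_row_def by auto
  qed (use no_vline in blast)
qed

context
  assumes marked_no_jump: "marked \<inter> J = {}"
begin

lemma column_no_jump:
  assumes j: "j \<in> V" and y: "(ab j, y) \<in> I"
    and rows: "\<And>k. k \<in> H \<Longrightarrow> ht k \<in> closed_segment (yb j) y \<Longrightarrow> ab j \<in> hx k \<Longrightarrow> jump_free_row k"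
  shows "(ab j, y) \<notin> J"
proof (rule no_jump_along_column)
  let ?s = "(ab j, yb j)"
  show "?s \<notin> J" using marked_no_jump j unfolding marked_def by blast
  have segment: "closed_segment ?s (ab j, y) = {ab j} \<times> closed_segment (yb j) y"
    by (simp add: closed_segment_same_fst)
  show I: "closed_segment ?s (ab j, y) - {?s} \<subseteq> I"
    using lower_end_in_closure_I[OF j] y by (rule half_open_segment_subset_I)
  fix z b assume z: "z \<in> closed_segment ?s (ab j, y) - {?s}"
  then obtain t where t: "z = (ab j, t)" "t \<in> closed_segment (yb j) y" unfolding segment by auto
  then show "z \<in> closure (horizontal_arm b z - J)"
    using horizontal_arm_no_jump[OF j, of t b] rows z I by auto
qed simp

lemma row_no_jump:
  assumes k: "k \<in> H" and x: "(x, ht k) \<in> I"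
    and arms: "\<And>t b. (t, ht k) \<in> I \<Longrightarrow> t \<in> closed_segment (xl k) x - {xl k} \<Longrightarrow>
      (t, ht k) \<in> closure (vertical_arm b (t, ht k) - J)"
  shows "(x, ht k) \<notin> J"
proof (rule no_jump_along_row)
  let ?s = "(xl k, ht k)"
  show "?s \<notin> J" using marked_no_jump k unfolding marked_def by blast
  have segment: "closed_segment ?s (x, ht k) = closed_segment (xl k) x \<times> {ht k}"
    by (simp add: closed_segment_same_snd)
  show I: "closed_segment ?s (x, ht k) - {?s} \<subseteq> I"
    using left_end_in_closure_I[OF k] x by (rule half_open_segment_subset_I)
  fix z b assume z: "z \<in> closed_segment ?s (x, ht k) - {?s}"
  then obtain t where "z = (t, ht k)" "t \<in> closed_segment (xl k) x" unfolding segment by auto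
  then show "z \<in> closure (vertical_arm b z - J)" using arms[of t b] z I by auto
qed simp

lemma lower_piece_no_jump:
  assumes j: "j \<in> V" and y: "(ab j, y) \<in> I" "y \<in> interior (vy j)" "y \<le> yb j"
  shows "(ab j, y) \<notin> J"
proof (rule column_no_jump[OF j y(1)])
  fix k assume k: "k \<in> H" "ht k \<in> closed_segment (yb j) y" "ab j \<in> hx k"
  then have "y \<le> ht k" "ht k \<le> yb j" using y(3) by (auto simp: closed_segment_eq_real_ivl split: if_splits)
  then have "ht k \<in> interior (vy j)"
    using y(2) yt_in_vy[OF j] yb_less_yt[OF j] unfolding interior_vy_iff[OF j]
      by (meson le_less_trans less_le_trans)
  then have "ht k \<in> {yb j<..<yt j}" by (rule hx_stops_vy[OF k(1) j k(3)])
  then show "jump_free_row k" using \<open>ht k \<le> yb j\<close> by simp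
qed

lemma column_no_jump_beside_row:
  assumes k: "k \<in> H" "ab j \<in> interior (hx k)" and j: "j \<in> V" "ht k \<in> vy j"
    and y: "(ab j, y) \<in> I" "y \<in> vy j" "y \<noteq> ht k" "ht k < yb j \<Longrightarrow> y < yb j"
    and rows: "\<And>k'. k' \<in> H \<Longrightarrow> ht k' < ht k \<Longrightarrow> jump_free_row k'"
  shows "(ab j, y) \<notin> J"
proof -
  have outside: "ht k < yb j \<or> yt j < ht k"
    using segment_stops_hx[OF k(1) j(1)] ht_neq_end[OF k(1) j(1)] k(2) by fastforce
  have "ab j \<in> hx k" using k(2) interior_subset by blast
  then have "ht k \<notin> interior (vy j)" using hx_stops_vy[OF k(1) j(1)] outside by auto
  then have end_k: "vy j \<subseteq> {ht k..} \<or> vy j \<subseteq> {..ht k}"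
    unfolding interior_vy_iff[OF j(1)] by (auto simp: not_less)
  show ?thesis
  proof (cases "ht k < yb j")
    case True
    then have "ht k < y" using end_k yb_in_vy[OF j(1)] y(2,3) by fastforce
    then have "y \<in> interior (vy j)"
      unfolding interior_vy_iff[OF j(1)] using j(2) yb_in_vy[OF j(1)] y(4) True by blast
    then show ?thesis using lower_piece_no_jump[OF j(1) y(1)] y(4) True by simp
  next
    case False
    then have top: "yt j < ht k" using outside by blast
    then have "y < ht k" using end_k yt_in_vy[OF j(1)] y(2,3) by fastforce
    then have "t < ht k" if "t \<in> closed_segment (yb j) y" for t
      using that top yb_less_yt[OF j(1)] by (auto simp: closed_segment_eq_real_ivl split: if_splits)
    then show ?thesis using column_no_jump[OF j(1) y(1)] rows by blast
  qed
qed

lemma vertical_arm_no_jump: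
  assumes k: "k \<in> H" "(x, ht k) \<in> I" "x \<in> interior (hx k)"
    and rows: "\<And>k'. k' \<in> H \<Longrightarrow> ht k' < ht k \<Longrightarrow> jump_free_row k'"
  shows "(x, ht k) \<in> closure (vertical_arm b (x, ht k) - J)"
proof (rule arm_no_jump[OF k(2) in_closure_arm(2)])
  have "\<forall>\<^sub>F z in nhds (x, ht k). z \<in> {z. snd z < yb j}" if "ht k < yb j" for j
    using that by (intro eventually_nhds_in_open open_Collect_less continuous_intros) simp
  then show "\<forall>\<^sub>F z in nhds (x, ht k). \<forall>j\<in>V. ht k < yb j \<longrightarrow> snd z < yb j"
    by (intro eventually_ball_finite finite_V ballI) auto
  fix z assume z: "z \<in> vertical_arm b (x, ht k) \<inter> I" and near: "\<forall>j\<in>V. ht k < yb j \<longrightarrow> snd z < yb j"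
    and through: "\<forall>i\<in>H. z \<in> hline i \<longrightarrow> (x, ht k) \<in> hline i" "\<forall>j\<in>V. z \<in> vline j \<longrightarrow> (x, ht k) \<in> vline j"
    and "z \<in> L"
  obtain y where y: "z = (x, y)" "y \<noteq> ht k"
    using z by (cases z) (auto simp: vertical_arm_def half_line_def split: if_splits)
  from \<open>z \<in> L\<close> show "z \<notin> J"
  proof (cases rule: L_cases)
    case (horizontal i)
    then show ?thesis using through(1) y by auto
  next
    case (vertical j)
    then have "ab j = x" "y \<in> vy j" "ht k \<in> vy j" using through(2) y(1) by auto
    then show ?thesis
      using column_no_jump_beside_row[OF k(1) _ vertical(1) _ _ _ y(2)]
        rows k(3) z near vertical(1) y(1) by auto
  qed
qed

lemma jump_free_rows:
  assumes "k \<in> H"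
  shows "jump_free_row k"
  using assms
proof (induction "card {k'\<in>H. ht k' < ht k}" arbitrary: k rule: less_induct)
  case less
  note k = less.prems
  have rows: "jump_free_row k'" if "k' \<in> H" "ht k' < ht k" for k'
    using that finite_H by (intro less.hyps psubset_card_mono) auto
  have "(x, ht k) \<notin> J" if x: "x \<in> interior (hx k)" "(x, ht k) \<in> I" for x
  proof (rule row_no_jump[OF k x(2)])
    fix t b assume t: "(t, ht k) \<in> I" "t \<in> closed_segment (xl k) x - {xl k}"
    have "t \<in> interior (hx k)"
    proof (cases "t = x")
      case False
      then have "t \<in> open_segment x (xl k)" using t(2)
        by (auto simp: open_segment_def closed_segment_commute)
      moreover have "convex (hx k)" using is_interval_hx[OF k] by (rule is_interval_convex)
      moreover have "xl k \<in> closure (hx k)" using xl_in_hx[OF k] closure_subset by blast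
      ultimately show ?thesis using in_interior_closure_convex_segment x(1) by blast
    qed (use x(1) in simp)
    then show "(t, ht k) \<in> closure (vertical_arm b (t, ht k) - J)"
      by (rule vertical_arm_no_jump[OF k t(1) _ rows])
  qed
  then show ?case unfolding jump_free_row_def by blast
qed

lemma no_jump_in_I: "I \<inter> J = {}"
proof -
  have "w \<notin> J" if w: "w \<in> I" for w
  proof (cases "w \<in> L")
    case False
    then show ?thesis using off_jump w by blast
  next
    case True
    then show ?thesis
    proof (cases rule: L_cases)
      case (vertical j)
      then show ?thesis using column_no_jump[of j "snd w"] jump_free_rows w by (cases w) auto
    next
      case (horizontal k)
      then obtain x where x: "w = (x, ht k)" "x \<in> hx k" by auto
      show ?thesis
      proof (cases "x \<in> interior (hx k)")
        case True
        then show ?thesis using jump_free_rows[OF horizontal(1)] w x(1) unfolding jump_free_row_def by blast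
      next
        case False
        then obtain j where "j \<in> V" "ab j = x"
          using hx_ends_on_segment[OF horizontal(1) x(2)] w x(1) by blast
        then show ?thesis using column_no_jump[of j "ht k"] jump_free_rows w x(1) by auto
      qed
    qed
  qed
  then show ?thesis by blast
qed

lemma no_jump_imp_trivial: "A \<subseteq> U \<or> A \<inter> U = {}"
proof -
  have "p \<in> U \<longleftrightarrow> q \<in> U" if "p \<in> A" "q \<in> A" for p q
    using that convex_connected[OF convex_I] I_subset_closure_A no_jump_in_I
    by (intro connected_disjoint_jump_set[of I A]) auto
  then show ?thesis by blast
qed

end

end

theorem spans_dual_tree_marked: "spans_dual_tree A marked"
  unfolding spans_dual_tree_def using marked_two_sided marked_single_jump no_jump_imp_trivial by blast

end

section \<open>Rotation by 180 degrees\<close>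

lemma uminus_image_Times: "uminus ` (X \<times> Y) = uminus ` X \<times> uminus ` Y"
  for X :: "'a::group_add set" and Y :: "'b::group_add set"
  by (force simp: image_iff)

lemma mem_uminus_image: "x \<in> uminus ` X \<longleftrightarrow> - x \<in> X" for x :: "'a::group_add"
  by (metis image_iff minus_minus)

context extended_segments
begin

lemma extended_segments_uminus:
  "extended_segments (uminus ` I) H V (\<lambda>k. - ht k) (\<lambda>k. - xr k) (\<lambda>k. - xl k) (\<lambda>k. uminus ` hx k)
     (\<lambda>j. - ab j) (\<lambda>j. - yt j) (\<lambda>j. - yb j) (\<lambda>j. uminus ` vy j)"
proof
  show "open (uminus ` I)" "convex (uminus ` I)"
    using open_I convex_I by (simp_all add: open_negations convex_negations)
  show "inj_on (\<lambda>k. - ht k) H" "inj_on (\<lambda>j. - ab j) V"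
    using inj_ht inj_ab by (simp_all add: inj_on_def)
next
  fix k assume k: "k \<in> H"
  show "closed (uminus ` hx k)" "is_interval (uminus ` hx k)"
    using closed_hx[OF k] is_interval_hx[OF k] by (simp_all add: closed_negations)
  show "- xr k < - xl k" "{- xr k..- xl k} \<subseteq> uminus ` hx k" "{- xr k<..<- xl k} \<times> {- ht k} \<subseteq> uminus ` I"
    using xl_less_xr[OF k] image_mono[OF segment_subset_hx[OF k], of uminus]
      image_mono[OF hsegment_subset_I[OF k], of uminus] by (simp_all add: uminus_image_Times)
  show "\<exists>j\<in>V. - ab j = x \<and> - ht k \<in> {- yt j<..<- yb j}"
    if "x \<in> uminus ` hx k" "x \<notin> interior (uminus ` hx k)" "(x, - ht k) \<in> uminus ` I" for x
    using hx_ends_on_segment[OF k, of "- x"] that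
    by (force simp: mem_uminus_image interior_negations)
next
  fix j assume j: "j \<in> V"
  show "closed (uminus ` vy j)" "is_interval (uminus ` vy j)"
    using closed_vy[OF j] is_interval_vy[OF j] by (simp_all add: closed_negations)
  show "- yt j < - yb j" "{- yt j..- yb j} \<subseteq> uminus ` vy j" "{- ab j} \<times> {- yt j<..<- yb j} \<subseteq> uminus ` I"
    using yb_less_yt[OF j] image_mono[OF segment_subset_vy[OF j], of uminus]
      image_mono[OF vsegment_subset_I[OF j], of uminus] by (simp_all add: uminus_image_Times)
  show "\<exists>k\<in>H. - ht k = y \<and> - ab j \<in> interior (uminus ` hx k)"
    if "y \<in> uminus ` vy j" "y \<notin> interior (uminus ` vy j)" "(- ab j, y) \<in> uminus ` I" for y
    using vy_ends_on_hx[OF j, of "- y"] that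
    by (force simp: mem_uminus_image interior_negations)
next
  fix k j assume kj: "k \<in> H" "j \<in> V"
  show "- ab j \<noteq> - xr k \<and> - ab j \<noteq> - xl k" "- ht k \<noteq> - yt j \<and> - ht k \<noteq> - yb j"
    using ab_neq_end[OF kj] ht_neq_end[OF kj] by auto
  show "- ab j \<notin> interior (uminus ` hx k)" if "- ht k \<in> {- yt j<..<- yb j}"
    using segment_stops_hx[OF kj] that by (simp add: mem_uminus_image interior_negations)
  show "- ht k \<in> {- yt j<..<- yb j}" if "- ab j \<in> uminus ` hx k" "- ht k \<in> interior (uminus ` vy j)"
    using hx_stops_vy[OF kj] that by (simp add: mem_uminus_image interior_negations)
qed (rule finite_H finite_V)+

definition unmarked :: "point set" where
  "unmarked = (\<lambda>k. (xr k, ht k)) ` H \<union> (\<lambda>j. (ab j, yt j)) ` V"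

lemma unmarked_subset_L: "unmarked \<subseteq> L"
  unfolding unmarked_def L_def using xr_in_hx yt_in_vy by auto

lemma finite_unmarked: "finite unmarked"
  unfolding unmarked_def using finite_H finite_V by simp

theorem spans_dual_tree_unmarked: "spans_dual_tree A unmarked"
proof -
  interpret rotated: extended_segments "uminus ` I" H V "\<lambda>k. - ht k" "\<lambda>k. - xr k" "\<lambda>k. - xl k"
    "\<lambda>k. uminus ` hx k" "\<lambda>j. - ab j" "\<lambda>j. - yt j" "\<lambda>j. - yb j" "\<lambda>j. uminus ` vy j"
    by (rule extended_segments_uminus)
  have "uminus ` rotated.marked = unmarked"
    unfolding rotated.marked_def unmarked_def image_Un image_image by simp
  moreover have "uminus ` rotated.L = L"
    unfolding rotated.L_def L_def image_Un image_UN uminus_image_Times image_image by simp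
  then have "uminus ` rotated.A = A"
    by (simp add: image_set_diff image_image)
  ultimately show ?thesis
    using spans_dual_tree_uminus[OF rotated.spans_dual_tree_marked] by simp
qed

end

section \<open>Prolonged segments\<close>

definition prolong :: "real set \<Rightarrow> real \<Rightarrow> real \<Rightarrow> real set" where
  "prolong D a b = {x. (\<forall>t\<in>D. b \<le> t \<longrightarrow> x \<le> t) \<and> (\<forall>t\<in>D. t \<le> a \<longrightarrow> t \<le> x)}"

lemma closed_prolong: "closed (prolong D a b)"
proof -
  have "prolong D a b = (\<Inter>t\<in>{t\<in>D. b \<le> t}. {..t}) \<inter> (\<Inter>t\<in>{t\<in>D. t \<le> a}. {t..})"
    unfolding prolong_def by auto
  then show ?thesis by (simp add: closed_Int closed_INT)
qed

lemma is_interval_prolong: "is_interval (prolong D a b)"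
  unfolding is_interval_1 prolong_def by (auto intro: order_trans)

lemma segment_subset_prolong: "{a..b} \<subseteq> prolong D a b"
  unfolding prolong_def by auto

lemma interior_prolong:
  assumes "closed D" "x \<in> prolong D a b" "x \<notin> D"
  shows "x \<in> interior (prolong D a b)"
proof -
  obtain e where e: "e > 0" "ball x e \<subseteq> - D" using assms(1,3) by (meson ComplI open_Compl openE)
  have "y \<in> prolong D a b" if y: "y \<in> ball x e" for y
  proof -
    have D: "t \<notin> ball x e" if "t \<in> D" for t using e(2) that by blast
    have "y \<le> t" if "t \<in> D" "x \<le> t" for t using D[OF that(1)] that(2) y by (simp add: dist_real_def)
    moreover have "t \<le> y" if "t \<in> D" "t \<le> x" for t
      using D[OF that(1)] that(2) y by (simp add: dist_real_def)
    ultimately show ?thesis using assms(2) unfolding prolong_def by blast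
  qed
  then show ?thesis using e(1) by (auto simp: mem_interior)
qed

lemma interior_prolong_Int:
  assumes "t \<in> D" "t \<in> interior (prolong D a b)"
  shows "t \<in> {a<..<b}"
proof -
  obtain u v where "u \<in> prolong D a b" "u < t" "v \<in> prolong D a b" "t < v"
    using assms(2) unfolding interior_interval_iff[OF is_interval_prolong] by blast
  then have "a < t" "t < b" using assms(1) unfolding prolong_def by force+
  then show ?thesis by simp
qed

definition extended_segment :: "point set \<Rightarrow> point set \<Rightarrow> point set" where
  "extended_segment B e = convex hull e \<union> (\<Union>v\<in>e. \<Union>w\<in>e - {v}. drawn_ray B v w)"

lemma not_hit_before_iff:
  fixes b c r :: real
  assumes "c > 0"
  shows "(\<forall>s. 0 \<le> s \<and> s < r \<longrightarrow> b + s * c \<notin> D) \<longleftrightarrow> (\<forall>t\<in>D. b \<le> t \<longrightarrow> b + r * c \<le> t)"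
proof
  assume free: "\<forall>s. 0 \<le> s \<and> s < r \<longrightarrow> b + s * c \<notin> D"
  show "\<forall>t\<in>D. b \<le> t \<longrightarrow> b + r * c \<le> t"
  proof (intro ballI impI)
    fix t assume t: "t \<in> D" "b \<le> t"
    have "b + (t - b) / c * c = t" using assms by simp
    then have "\<not> (t - b) / c < r" using free[rule_format, of "(t - b) / c"] t assms by auto
    then show "b + r * c \<le> t" using assms by (simp add: field_simps)
  qed
next
  assume hit: "\<forall>t\<in>D. b \<le> t \<longrightarrow> b + r * c \<le> t"
  show "\<forall>s. 0 \<le> s \<and> s < r \<longrightarrow> b + s * c \<notin> D"
  proof (intro allI impI notI)
    fix s assume s: "0 \<le> s \<and> s < r" "b + s * c \<in> D"
    then have "b + r * c \<le> b + s * c" using hit[rule_format, of "b + s * c"] assms by simp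
    then show False using s(1) assms by simp
  qed
qed

lemma drawn_ray_affine:
  fixes f :: "real \<Rightarrow> point"
  assumes f: "\<And>t. f t = p + t *\<^sub>R u" and ab: "a < b"
  shows "drawn_ray B (f b) (f a) = f ` {x. b \<le> x \<and> (\<forall>t\<in>f -` B. b \<le> t \<longrightarrow> x \<le> t)}" (is "_ = f ` ?X")
proof -
  have line: "f b + s *\<^sub>R (f b - f a) = f (b + s * (b - a))" for s
    unfolding f by (simp add: algebra_simps)
  have "(\<forall>s. 0 \<le> s \<and> s < r \<longrightarrow> f (b + s * (b - a)) \<notin> B) \<longleftrightarrow>
      (\<forall>t\<in>f -` B. b \<le> t \<longrightarrow> b + r * (b - a) \<le> t)" for r
    using not_hit_before_iff[of "b - a" r b "f -` B"] ab by simp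
  then have ray: "drawn_ray B (f b) (f a) =
      {f (b + r * (b - a)) | r. 0 \<le> r \<and> (\<forall>t\<in>f -` B. b \<le> t \<longrightarrow> b + r * (b - a) \<le> t)}" (is "_ = ?Y")
    unfolding drawn_ray_def line by simp
  have "f x \<in> ?Y" if "x \<in> ?X" for x
  proof -
    have "b + (x - b) / (b - a) * (b - a) = x" using ab by simp
    then show ?thesis using that ab by (intro CollectI exI[of _ "(x - b) / (b - a)"]) simp
  qed
  moreover have "?Y \<subseteq> f ` ?X" using ab by auto
  ultimately show ?thesis unfolding ray by blast
qed

lemma drawn_ray_affine_backwards:
  fixes f :: "real \<Rightarrow> point"
  assumes f: "\<And>t. f t = p + t *\<^sub>R u" and ab: "a < b"
  shows "drawn_ray B (f a) (f b) = f ` {x. x \<le> a \<and> (\<forall>t\<in>f -` B. t \<le> a \<longrightarrow> t \<le> x)}" (is "_ = f ` ?X")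
proof -
  let ?g = "\<lambda>t. f (- t)"
  let ?Y = "{x. - a \<le> x \<and> (\<forall>t\<in>?g -` B. - a \<le> t \<longrightarrow> x \<le> t)}"
  have "drawn_ray B (?g (- a)) (?g (- b)) = ?g ` ?Y"
    using ab by (intro drawn_ray_affine[of _ p "- u"]) (simp_all add: f)
  also have "\<dots> = f ` uminus ` ?Y" unfolding image_image ..
  also have "uminus ` ?Y = ?X"
  proof -
    have "(\<forall>t\<in>?g -` B. - a \<le> t \<longrightarrow> - x \<le> t) \<longleftrightarrow> (\<forall>t. f (- t) \<in> B \<longrightarrow> - t \<le> a \<longrightarrow> - t \<le> x)" for x
      by (auto simp: minus_le_iff)
    moreover have "(\<forall>t. f (- t) \<in> B \<longrightarrow> - t \<le> a \<longrightarrow> - t \<le> x) \<longleftrightarrow> (\<forall>t\<in>f -` B. t \<le> a \<longrightarrow> t \<le> x)" for x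
      by (metis minus_minus vimage_eq)
    ultimately show ?thesis by (auto simp: set_eq_iff mem_uminus_image)
  qed
  finally show ?thesis by simp
qed

lemma closed_segment_affine:
  fixes f :: "real \<Rightarrow> 'a::real_vector"
  assumes "\<And>t. f t = p + t *\<^sub>R u" "a \<le> b"
  shows "closed_segment (f a) (f b) = f ` {a..b}"
proof -
  have "(1 - r) *\<^sub>R f a + r *\<^sub>R f b = f ((1 - r) *\<^sub>R a + r *\<^sub>R b)" for r
    unfolding assms(1) by (simp add: algebra_simps)
  then have "closed_segment (f a) (f b) = f ` closed_segment a b"
    unfolding closed_segment_image_interval image_image by simp
  then show ?thesis using assms(2) by (simp add: closed_segment_eq_real_ivl)
qed

lemma extended_segment_affine:
  fixes f :: "real \<Rightarrow> point"
  assumes f: "\<And>t. f t = p + t *\<^sub>R u" and u: "u \<noteq> 0" and ab: "a < b"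
  shows "extended_segment B {f a, f b} = f ` prolong (f -` B) a b"
proof -
  have "f a \<noteq> f b" using ab u by (simp add: f)
  then have "extended_segment B {f a, f b} =
      closed_segment (f a) (f b) \<union> drawn_ray B (f b) (f a) \<union> drawn_ray B (f a) (f b)"
    unfolding extended_segment_def segment_convex_hull by auto
  also have "\<dots> = f ` prolong (f -` B) a b"
    unfolding closed_segment_affine[OF f less_imp_le[OF ab]] drawn_ray_affine[OF f ab]
      drawn_ray_affine_backwards[OF f ab] image_Un[symmetric]
    using ab by (intro arg_cong[where f = "image f"]) (force simp: prolong_def)
  finally show ?thesis .
qed

lemma drawn_ray_subset: "drawn_ray B v w \<subseteq> drawn_ray {} v w"
  unfolding drawn_ray_def by auto

lemma drawn_ray_cong:
  assumes "\<And>z. z \<in> drawn_ray {} v w \<Longrightarrow> z \<in> B \<longleftrightarrow> z \<in> B'"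
  shows "drawn_ray B v w = drawn_ray B' v w"
proof -
  have "v + s *\<^sub>R (v - w) \<in> B \<longleftrightarrow> v + s *\<^sub>R (v - w) \<in> B'" if "0 \<le> s" for s
    using assms[of "v + s *\<^sub>R (v - w)"] that unfolding drawn_ray_def by auto
  then have "(\<forall>s. 0 \<le> s \<and> s < t \<longrightarrow> v + s *\<^sub>R (v - w) \<notin> B) \<longleftrightarrow>
      (\<forall>s. 0 \<le> s \<and> s < t \<longrightarrow> v + s *\<^sub>R (v - w) \<notin> B')" for t by blast
  then show ?thesis unfolding drawn_ray_def by simp
qed

lemma opposite_drawn_rays_disjoint:
  assumes "v \<noteq> w"
  shows "drawn_ray {} v w \<inter> drawn_ray {} w v = {}"
proof -
  have False if "0 \<le> s" "0 \<le> t" "v + s *\<^sub>R (v - w) = w + t *\<^sub>R (w - v)" for s t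
  proof -
    have "(1 + s + t) *\<^sub>R (v - w) = 0" using that(3) by (simp add: algebra_simps)
    then show False using assms that(1,2) by simp
  qed
  then show ?thesis unfolding drawn_ray_def by blast
qed

lemma draw_rays_append: "draw_rays C M R (us @ vs) = draw_rays C M (draw_rays C M R us) vs"
  by (induction us arbitrary: R) auto

definition obstacles :: "point set \<Rightarrow> point set set \<Rightarrow> point set \<Rightarrow> point set \<Rightarrow> point set" where
  "obstacles C M R e = (\<Union>f \<in> M - {e}. convex hull f) \<union> R \<union> frontier C"

lemma draw_rays_Cons:
  "draw_rays C M R (v # vs) =
    draw_rays C M (R \<union> drawn_ray (obstacles C M R {v, partner M v}) v (partner M v)) vs"
  unfolding obstacles_def by simp

text \<open>Pairwise disjoint full rays do not block each other, so their order is irrelevant.\<close>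

lemma draw_rays_disjoint:
  assumes "distinct vs"
    and "\<And>u v. u \<in> set vs \<Longrightarrow> v \<in> set vs \<Longrightarrow> u \<noteq> v \<Longrightarrow>
      drawn_ray {} u (partner M u) \<inter> drawn_ray {} v (partner M v) = {}"
  shows "draw_rays C M R vs =
    R \<union> (\<Union>v\<in>set vs. drawn_ray (obstacles C M R {v, partner M v}) v (partner M v))"
  using assms
proof (induction vs arbitrary: R)
  case (Cons v vs)
  let ?D = "drawn_ray (obstacles C M R {v, partner M v}) v (partner M v)"
  have "drawn_ray (obstacles C M (R \<union> ?D) {u, partner M u}) u (partner M u) =
      drawn_ray (obstacles C M R {u, partner M u}) u (partner M u)" if u: "u \<in> set vs" for u
  proof (rule drawn_ray_cong)
    fix z assume z: "z \<in> drawn_ray {} u (partner M u)"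
    have "z \<notin> ?D"
      using Cons.prems(2)[of u v] Cons.prems(1) u z drawn_ray_subset[of _ v "partner M v"] by auto
    then show "z \<in> obstacles C M (R \<union> ?D) {u, partner M u} \<longleftrightarrow> z \<in> obstacles C M R {u, partner M u}"
      unfolding obstacles_def by blast
  qed
  then show ?case unfolding draw_rays_Cons using Cons.IH[of "R \<union> ?D"] Cons.prems by auto
qed simp

section \<open>Axis-parallel matchings\<close>

definition left_x :: "point set \<Rightarrow> real" where "left_x e = Min (fst ` e)"
definition right_x :: "point set \<Rightarrow> real" where "right_x e = Max (fst ` e)"
definition low_y :: "point set \<Rightarrow> real" where "low_y e = Min (snd ` e)"
definition high_y :: "point set \<Rightarrow> real" where "high_y e = Max (snd ` e)"

lemma collinear_level:
  fixes B :: "point set"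
  assumes "c = fst \<or> c = snd" "\<And>p. p \<in> B \<Longrightarrow> c p = y"
  shows "collinear B"
  using assms(1)
proof
  assume "c = fst"
  then have "p - q = (snd p - snd q) *\<^sub>R (0, 1)" if "p \<in> B" "q \<in> B" for p q
    using assms(2) that by (simp add: prod_eq_iff)
  then show ?thesis unfolding collinear_def by blast
next
  assume "c = snd"
  then have "p - q = (fst p - fst q) *\<^sub>R (1, 0)" if "p \<in> B" "q \<in> B" for p q
    using assms(2) that by (simp add: prod_eq_iff)
  then show ?thesis unfolding collinear_def by blast
qed

locale axis_matching =
  fixes P :: "point set" and M :: "point set set" and C :: "point set"
  assumes matching: "perfect_matching P M"
    and position: "general_position P"
    and parallel: "axis_parallel M"
    and convex_C: "convex C"
    and hull_C: "\<And>e. e \<in> M \<Longrightarrow> convex hull e \<subseteq> C"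
    and hull_frontier: "\<And>e. e \<in> M \<Longrightarrow> \<not> convex hull e \<subseteq> frontier C"
begin

lemma edgeE:
  assumes "e \<in> M"
  obtains v w where "v \<in> P" "w \<in> P" "v \<noteq> w" "e = {v, w}"
  using matching assms unfolding perfect_matching_def geometric_graph_def by blast

lemma finite_P: "finite P"
  using matching unfolding perfect_matching_def geometric_graph_def by blast

lemma edge_subset: "e \<in> M \<Longrightarrow> e \<subseteq> P"
  by (auto elim: edgeE)

lemma finite_M: "finite M"
  using finite_subset[of M "Pow P"] finite_P edge_subset by auto

lemma finite_edge: "e \<in> M \<Longrightarrow> finite e"
  using edge_subset finite_P finite_subset by blast

lemma edge_eq:
  assumes "e \<in> M" "f \<in> M" "v \<in> e" "v \<in> f"
  shows "e = f"
proof -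
  have "v \<in> P" using assms edge_subset by blast
  then have "card {e \<in> M. v \<in> e} = 1" using matching unfolding perfect_matching_def by blast
  then obtain g where "{e \<in> M. v \<in> e} = {g}" by (rule card_1_singletonE)
  moreover have "e \<in> {e \<in> M. v \<in> e}" "f \<in> {e \<in> M. v \<in> e}" using assms by auto
  ultimately show ?thesis by simp
qed

lemma hulls_disjoint:
  assumes "e \<in> M" "f \<in> M" "e \<noteq> f"
  shows "convex hull e \<inter> convex hull f = {}"
proof -
  have "convex hull e \<inter> convex hull f \<subseteq> e \<inter> f"
    using matching assms unfolding perfect_matching_def noncrossing_def by simp
  moreover have "e \<inter> f = {}" using edge_eq[OF assms(1,2)] assms(3) by blast
  ultimately show ?thesis by simp
qed

lemma partner_eq:
  assumes "{v, w} \<in> M"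
  shows "partner M v = w"
  unfolding partner_def
proof (rule the_equality[where P = "\<lambda>w. {v, w} \<in> M", OF assms])
  fix u assume "{v, u} \<in> M"
  then have "{v, u} = {v, w}" using edge_eq assms by blast
  then show "u = w" by (auto simp: doubleton_eq_iff)
qed

lemma edge_partner:
  assumes "e \<in> M" "v \<in> e"
  shows "{v, partner M v} = e" "partner M v \<noteq> v"
proof -
  obtain a b where ab: "a \<noteq> b" "e = {a, b}" using assms(1) by (rule edgeE)
  moreover from this have "partner M a = b" "partner M b = a"
    using partner_eq[of a b] partner_eq[of b a] assms(1) by (simp_all add: insert_commute)
  ultimately show "{v, partner M v} = e" "partner M v \<noteq> v" using assms(2) by auto
qed

definition level_edges :: "(point \<Rightarrow> real) \<Rightarrow> point set set" where
  "level_edges c = {e \<in> M. \<forall>u\<in>e. \<forall>v\<in>e. c u = c v}"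

abbreviation horizontals :: "point set set" where
  "horizontals \<equiv> level_edges snd"

abbreviation verticals :: "point set set" where
  "verticals \<equiv> level_edges fst"

lemma level_edges_subset: "level_edges c \<subseteq> M"
  unfolding level_edges_def by blast

lemma finite_level_edges: "finite (level_edges c)"
  using finite_subset[OF level_edges_subset finite_M] .

lemma edge_coordinates:
  assumes "e \<in> M"
  shows "e \<in> horizontals \<and> e \<notin> verticals \<and> left_x e < right_x e \<and> high_y e = low_y e \<and>
      e = {(left_x e, low_y e), (right_x e, low_y e)} \<or>
    e \<in> verticals \<and> e \<notin> horizontals \<and> low_y e < high_y e \<and> right_x e = left_x e \<and>
      e = {(left_x e, low_y e), (left_x e, high_y e)}"
proof -
  obtain v w where vw: "v \<noteq> w" "e = {v, w}" using edgeE[OF assms] by blast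
  then have "fst v = fst w \<or> snd v = snd w" using parallel assms unfolding axis_parallel_def by blast
  then show ?thesis
    using vw assms unfolding level_edges_def left_x_def right_x_def low_y_def high_y_def
    by (cases v; cases w) (auto simp: min_def max_def)
qed

lemma M_eq: "M = horizontals \<union> verticals" and horizontals_verticals_disjoint: "horizontals \<inter> verticals = {}"
  using edge_coordinates level_edges_subset by blast+

lemma horizontal_edge:
  assumes "k \<in> horizontals"
  shows "left_x k < right_x k" "high_y k = low_y k" "k = {(left_x k, low_y k), (right_x k, low_y k)}"
  using assms edge_coordinates[of k] level_edges_subset by blast+

lemma vertical_edge:
  assumes "j \<in> verticals"
  shows "low_y j < high_y j" "right_x j = left_x j" "j = {(left_x j, low_y j), (left_x j, high_y j)}"
  using assms edge_coordinates[of j] level_edges_subset by blast+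

lemma horizontal_ends: "k \<in> horizontals \<Longrightarrow> (left_x k, low_y k) \<in> k \<and> (right_x k, low_y k) \<in> k"
  and vertical_ends: "j \<in> verticals \<Longrightarrow> (left_x j, low_y j) \<in> j \<and> (left_x j, high_y j) \<in> j"
  using horizontal_edge(3) vertical_edge(3) by blast+

lemma horizontal_hull:
  assumes "k \<in> horizontals"
  shows "convex hull k = {left_x k..right_x k} \<times> {low_y k}"
proof -
  have "convex hull k = closed_segment (left_x k, low_y k) (right_x k, low_y k)"
    unfolding segment_convex_hull using horizontal_edge(3)[OF assms] by simp
  then show ?thesis
    using horizontal_edge(1)[OF assms] by (simp add: closed_segment_same_snd closed_segment_eq_real_ivl)
qed

lemma vertical_hull:
  assumes "j \<in> verticals"
  shows "convex hull j = {left_x j} \<times> {low_y j..high_y j}"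
proof -
  have "convex hull j = closed_segment (left_x j, low_y j) (left_x j, high_y j)"
    unfolding segment_convex_hull using vertical_edge(3)[OF assms] by simp
  then show ?thesis
    using vertical_edge(1)[OF assms] by (simp add: closed_segment_same_fst closed_segment_eq_real_ivl)
qed

lemma level_edge_mem:
  assumes c: "c = fst \<or> c = snd" and e: "e \<in> level_edges c" "u \<in> e" and v: "v \<in> P" "c v = c u"
  shows "v \<in> e"
proof (rule ccontr)
  assume "v \<notin> e"
  obtain a b where ab: "a \<in> P" "b \<in> P" "a \<noteq> b" "e = {a, b}" using edgeE e(1) level_edges_subset by blast
  then have "\<not> collinear {a, b, v}"
    using position v(1) \<open>v \<notin> e\<close> unfolding general_position_def by auto
  moreover have "collinear {a, b, v}"
    using e v(2) ab(4) unfolding level_edges_def by (intro collinear_level[OF c, of _ "c u"]) auto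
  ultimately show False by blast
qed

lemma level_eq_imp_edge_eq:
  assumes c: "c = fst \<or> c = snd" and e: "e \<in> level_edges c" "u \<in> e" and f: "f \<in> M" "v \<in> f" "c v = c u"
  shows "f = e"
  using level_edge_mem[OF c e _ f(3)] f(1,2) e(1) edge_eq edge_subset level_edges_subset by blast

lemma inj_low_y: "inj_on low_y horizontals"
proof
  fix k k' assume k: "k \<in> horizontals" "k' \<in> horizontals" "low_y k = low_y k'"
  then have "(left_x k, low_y k) \<in> k" "(left_x k', low_y k') \<in> k'" "k \<in> M"
    using horizontal_ends level_edges_subset by blast+
  then show "k = k'" using level_eq_imp_edge_eq[of snd k'] k(2,3) by (metis snd_conv)
qed

lemma inj_left_x: "inj_on left_x verticals"
proof
  fix j j' assume j: "j \<in> verticals" "j' \<in> verticals" "left_x j = left_x j'"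
  then have "(left_x j, low_y j) \<in> j" "(left_x j', low_y j') \<in> j'" "j \<in> M"
    using vertical_ends level_edges_subset by blast+
  then show "j = j'" using level_eq_imp_edge_eq[of fst j'] j(2,3) by (metis fst_conv)
qed

lemma low_y_neq_vertical_end:
  assumes k: "k \<in> horizontals" and j: "j \<in> verticals"
  shows "low_y k \<noteq> low_y j" "low_y k \<noteq> high_y j"
proof -
  have "j \<noteq> k" "j \<in> M" using k j horizontals_verticals_disjoint level_edges_subset by blast+
  then show "low_y k \<noteq> low_y j" "low_y k \<noteq> high_y j"
    using level_eq_imp_edge_eq[of snd k "(left_x k, low_y k)" j] k horizontal_ends[OF k] vertical_ends[OF j]
    by (metis snd_conv)+
qed

lemma left_x_neq_horizontal_end:
  assumes k: "k \<in> horizontals" and j: "j \<in> verticals"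
  shows "left_x j \<noteq> left_x k" "left_x j \<noteq> right_x k"
proof -
  have "k \<noteq> j" "k \<in> M" using k j horizontals_verticals_disjoint level_edges_subset by blast+
  then show "left_x j \<noteq> left_x k" "left_x j \<noteq> right_x k"
    using level_eq_imp_edge_eq[of fst j "(left_x j, low_y j)" k] j horizontal_ends[OF k] vertical_ends[OF j]
    by (metis fst_conv)+
qed

lemma interior_C_nonempty: "e \<in> M \<Longrightarrow> interior C \<noteq> {}"
  using hull_C[of e] hull_frontier[of e] closure_subset[of C] unfolding frontier_def by blast

lemma open_segment_subset_interior:
  assumes e: "{v, w} \<in> M" and "v \<noteq> w"
  shows "open_segment v w \<subseteq> interior C"
proof -
  have "closed_segment v w \<subseteq> closure C" "\<not> closed_segment v w \<subseteq> frontier C"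
    using hull_C[OF e] hull_frontier[OF e] closure_subset[of C] unfolding segment_convex_hull by blast+
  moreover have "interior C \<noteq> {}" using interior_C_nonempty[OF e] .
  ultimately have "rel_interior (closed_segment v w) \<subseteq> interior C"
    using subset_rel_interior_convex[OF convex_closed_segment convex_C, of v w]
    by (simp add: rel_frontier_nonempty_interior rel_interior_nonempty_interior)
  then show ?thesis using assms(2) by (simp only: rel_interior_closed_segment if_False)
qed

lemma horizontal_interior:
  assumes k: "k \<in> horizontals"
  shows "{left_x k<..<right_x k} \<times> {low_y k} \<subseteq> interior C"
proof -
  have "open_segment (left_x k, low_y k) (right_x k, low_y k) \<subseteq> interior C"
    using k horizontal_edge[OF k] level_edges_subset by (intro open_segment_subset_interior) auto
  then show ?thesis
    using horizontal_edge(1)[OF k]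
    by (auto simp: open_segment_def closed_segment_same_snd closed_segment_eq_real_ivl subset_iff)
qed

lemma vertical_interior:
  assumes j: "j \<in> verticals"
  shows "{left_x j} \<times> {low_y j<..<high_y j} \<subseteq> interior C"
proof -
  have "open_segment (left_x j, low_y j) (left_x j, high_y j) \<subseteq> interior C"
    using j vertical_edge[OF j] level_edges_subset by (intro open_segment_subset_interior) auto
  then show ?thesis
    using vertical_edge(1)[OF j]
    by (auto simp: open_segment_def closed_segment_same_fst closed_segment_eq_real_ivl subset_iff)
qed

definition hx :: "point set \<Rightarrow> real set" where
  "hx k = prolong {x. (x, low_y k) \<in> obstacles C M {} k} (left_x k) (right_x k)"

definition hlines :: "point set" where
  "hlines = (\<Union>k\<in>horizontals. hx k \<times> {low_y k})"

definition vy :: "point set \<Rightarrow> real set" where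
  "vy j = prolong {y. (left_x j, y) \<in> obstacles C M hlines j} (low_y j) (high_y j)"

lemma closed_obstacles:
  assumes "closed R"
  shows "closed (obstacles C M R e)"
proof -
  have "closed (convex hull f)" if "f \<in> M - {e}" for f
    using that finite_edge by (intro compact_imp_closed compact_convex_hull finite_imp_compact) auto
  then show ?thesis unfolding obstacles_def using assms finite_M by auto
qed

lemma closed_row: "closed B \<Longrightarrow> closed {x. (x, y) \<in> B}" for B :: "point set"
  using closed_vimage[of B "\<lambda>x. (x, y)"] by (simp add: vimage_def continuous_intros)

lemma closed_column: "closed B \<Longrightarrow> closed {y. (x, y) \<in> B}" for B :: "point set"
  using closed_vimage[of B "\<lambda>y. (x, y)"] by (simp add: vimage_def continuous_intros)

lemma closed_hlines: "closed hlines"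
  unfolding hlines_def hx_def
  by (intro closed_UN finite_level_edges ballI closed_Times closed_prolong closed_singleton)

lemma horizontal_hull_subset_hlines:
  assumes "k \<in> horizontals"
  shows "convex hull k \<subseteq> hlines"
  unfolding hlines_def hx_def horizontal_hull[OF assms] using assms segment_subset_prolong by blast

lemma obstacle_on_row:
  assumes k: "k \<in> horizontals" and x: "(x, low_y k) \<in> obstacles C M {} k" "(x, low_y k) \<in> interior C"
  shows "\<exists>j\<in>verticals. left_x j = x \<and> low_y k \<in> {low_y j<..<high_y j}"
proof -
  obtain f where f: "f \<in> M" "f \<noteq> k" "(x, low_y k) \<in> convex hull f"
    using x unfolding obstacles_def frontier_def by auto
  have "f \<notin> horizontals"
  proof
    assume "f \<in> horizontals"
    then show False using f(2,3) k inj_low_y by (auto simp: horizontal_hull dest: inj_onD)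
  qed
  then have j: "f \<in> verticals" using f(1) M_eq by blast
  then show ?thesis
    using f(3) low_y_neq_vertical_end[OF k j] by (intro bexI[of _ f]) (auto simp: vertical_hull)
qed

lemma obstacle_on_column:
  assumes j: "j \<in> verticals" and y: "(left_x j, y) \<in> obstacles C M hlines j" "(left_x j, y) \<in> interior C"
  shows "\<exists>k\<in>horizontals. low_y k = y \<and> left_x j \<in> hx k"
proof -
  consider "(left_x j, y) \<in> hlines" | f where "f \<in> M" "f \<noteq> j" "(left_x j, y) \<in> convex hull f"
    using y unfolding obstacles_def frontier_def by auto
  then have "(left_x j, y) \<in> hlines"
  proof cases
    case 2
    have "f \<notin> verticals"
    proof
      assume "f \<in> verticals"
      then show False using 2(2,3) j inj_left_x by (auto simp: vertical_hull dest: inj_onD)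
    qed
    then show ?thesis using 2(1,3) M_eq horizontal_hull_subset_hlines by blast
  qed
  then show ?thesis unfolding hlines_def by auto
qed

lemma hx_end:
  assumes k: "k \<in> horizontals" and x: "x \<in> hx k" "x \<notin> interior (hx k)" "(x, low_y k) \<in> interior C"
  shows "\<exists>j\<in>verticals. left_x j = x \<and> low_y k \<in> {low_y j<..<high_y j}"
proof -
  have "(x, low_y k) \<in> obstacles C M {} k"
    using interior_prolong[OF closed_row[OF closed_obstacles[OF closed_empty]]] x(1,2)
      unfolding hx_def by blast
  then show ?thesis using obstacle_on_row[OF k] x(3) by blast
qed

lemma vy_end:
  assumes j: "j \<in> verticals" and y: "y \<in> vy j" "y \<notin> interior (vy j)" "(left_x j, y) \<in> interior C"
  shows "\<exists>k\<in>horizontals. low_y k = y \<and> left_x j \<in> interior (hx k)"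
proof -
  have "(left_x j, y) \<in> obstacles C M hlines j"
    using interior_prolong[OF closed_column[OF closed_obstacles[OF closed_hlines]]] y(1,2)
      unfolding vy_def by blast
  then obtain k where k: "k \<in> horizontals" "low_y k = y" "left_x j \<in> hx k"
    using obstacle_on_column[OF j] y(3) by blast
  have "left_x j \<in> interior (hx k)"
  proof (rule ccontr)
    assume "left_x j \<notin> interior (hx k)"
    then obtain i where i: "i \<in> verticals" "left_x i = left_x j" "y \<in> {low_y i<..<high_y i}"
      using hx_end[OF k(1,3)] k(2) y(3) by blast
    then have "i = j" using inj_left_x j by (auto dest: inj_onD)
    moreover have "{low_y j<..<high_y j} \<subseteq> interior (vy j)"
      using segment_subset_prolong unfolding vy_def by (intro interior_maximal) (auto simp: subset_iff)
    ultimately show False using i(3) y(2) by blast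
  qed
  then show ?thesis using k by blast
qed

lemma vertical_stops_hx:
  assumes k: "k \<in> horizontals" and j: "j \<in> verticals" and crossing: "low_y k \<in> {low_y j<..<high_y j}"
  shows "left_x j \<notin> interior (hx k)"
proof
  assume inner: "left_x j \<in> interior (hx k)"
  have M: "k \<in> M" "j \<in> M" "k \<noteq> j" using k j level_edges_subset horizontals_verticals_disjoint by blast+
  have hit: "(left_x j, low_y k) \<in> convex hull j" using crossing vertical_hull[OF j] by auto
  then have obstacle: "left_x j \<in> {x. (x, low_y k) \<in> obstacles C M {} k}"
    using M(2,3) unfolding obstacles_def by blast
  have "left_x j \<in> {left_x k<..<right_x k}"
    by (rule interior_prolong_Int[OF obstacle inner[unfolded hx_def]])
  then have "(left_x j, low_y k) \<in> convex hull k" using horizontal_hull[OF k] by auto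
  then show False using hit hulls_disjoint[OF M] by blast
qed

lemma hx_stops_vertical:
  assumes k: "k \<in> horizontals" and hit: "left_x j \<in> hx k" "low_y k \<in> interior (vy j)"
  shows "low_y k \<in> {low_y j<..<high_y j}"
proof -
  have "(left_x j, low_y k) \<in> hlines" using hit(1) k unfolding hlines_def by auto
  then have "low_y k \<in> {y. (left_x j, y) \<in> obstacles C M hlines j}" unfolding obstacles_def by blast
  then show ?thesis by (rule interior_prolong_Int[OF _ hit(2)[unfolded vy_def]])
qed

sublocale extended_segments "interior C" horizontals verticals low_y left_x right_x hx
  left_x low_y high_y vy
proof
  show "open (interior C)" "convex (interior C)" using convex_C by (auto intro: convex_interior)
  show "finite horizontals" "finite verticals" by (rule finite_level_edges)+
  show "inj_on low_y horizontals" "inj_on left_x verticals" by (rule inj_low_y inj_left_x)+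
next
  fix k assume k: "k \<in> horizontals"
  show "closed (hx k)" "is_interval (hx k)" "{left_x k..right_x k} \<subseteq> hx k"
    unfolding hx_def by (rule closed_prolong is_interval_prolong segment_subset_prolong)+
  show "left_x k < right_x k" "{left_x k<..<right_x k} \<times> {low_y k} \<subseteq> interior C"
    using horizontal_edge(1)[OF k] horizontal_interior[OF k] .
  show "\<exists>j\<in>verticals. left_x j = x \<and> low_y k \<in> {low_y j<..<high_y j}"
    if "x \<in> hx k" "x \<notin> interior (hx k)" "(x, low_y k) \<in> interior C" for x
    using hx_end[OF k that] .
next
  fix j assume j: "j \<in> verticals"
  show "closed (vy j)" "is_interval (vy j)" "{low_y j..high_y j} \<subseteq> vy j"
    unfolding vy_def by (rule closed_prolong is_interval_prolong segment_subset_prolong)+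
  show "low_y j < high_y j" "{left_x j} \<times> {low_y j<..<high_y j} \<subseteq> interior C"
    using vertical_edge(1)[OF j] vertical_interior[OF j] .
  show "\<exists>k\<in>horizontals. low_y k = y \<and> left_x j \<in> interior (hx k)"
    if "y \<in> vy j" "y \<notin> interior (vy j)" "(left_x j, y) \<in> interior C" for y
    using vy_end[OF j that] .
next
  fix k j assume k: "k \<in> horizontals" and j: "j \<in> verticals"
  show "left_x j \<noteq> left_x k \<and> left_x j \<noteq> right_x k" "low_y k \<noteq> low_y j \<and> low_y k \<noteq> high_y j"
    using left_x_neq_horizontal_end[OF k j] low_y_neq_vertical_end[OF k j] by auto
  show "left_x j \<notin> interior (hx k)" if "low_y k \<in> {low_y j<..<high_y j}"
    using vertical_stops_hx[OF k j that] .
  show "low_y k \<in> {low_y j<..<high_y j}" if "left_x j \<in> hx k" "low_y k \<in> interior (vy j)"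
    using hx_stops_vertical[OF k that] .
qed

lemma L_eq: "L = hlines \<union> (\<Union>j\<in>verticals. {left_x j} \<times> vy j)"
  unfolding L_def hlines_def ..

lemma rays_disjoint:
  assumes c: "c = fst \<or> c = snd" and u: "u \<in> \<Union>(level_edges c)" and v: "v \<in> \<Union>(level_edges c)" and "u \<noteq> v"
  shows "drawn_ray {} u (partner M u) \<inter> drawn_ray {} v (partner M v) = {}"
proof -
  obtain e f where e: "e \<in> level_edges c" "u \<in> e" and f: "f \<in> level_edges c" "v \<in> f" using u v by blast
  have M: "e \<in> M" "f \<in> M" using e(1) f(1) level_edges_subset by blast+
  show ?thesis
  proof (cases "e = f")
    case True
    then have "v \<in> {u, partner M u}" "u \<in> {v, partner M v}"
      unfolding edge_partner(1)[OF M(1) e(2)] edge_partner(1)[OF M(2) f(2)] using e(2) f(2) by simp_all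
    then have "partner M u = v" "partner M v = u" using \<open>u \<noteq> v\<close> by auto
    then show ?thesis using opposite_drawn_rays_disjoint[OF \<open>u \<noteq> v\<close>] by simp
  next
    case False
    have level: "c z = c w" if "z \<in> drawn_ray {} w (partner M w)" "g \<in> level_edges c" "w \<in> g" for z w g
    proof -
      have "partner M w \<in> g" using edge_partner(1)[of g w] that(2,3) level_edges_subset by blast
      then have "c w = c (partner M w)" using that(2,3) unfolding level_edges_def by blast
      then show ?thesis using that(1) c unfolding drawn_ray_def by auto
    qed
    have "c u \<noteq> c v" using level_eq_imp_edge_eq[OF c e M(2) f(2)] False by metis
    then show ?thesis using level[OF _ e] level[OF _ f] unfolding disjoint_iff by metis
  qed
qed

lemma draw_level_edges:
  assumes c: "c = fst \<or> c = snd" and vs: "distinct vs" "set vs = \<Union>(level_edges c)"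
  shows "(\<Union>e\<in>level_edges c. convex hull e) \<union> draw_rays C M R vs =
    R \<union> (\<Union>e\<in>level_edges c. extended_segment (obstacles C M R e) e)"
proof -
  have "draw_rays C M R vs = R \<union> (\<Union>v\<in>\<Union>(level_edges c).
    drawn_ray (obstacles C M R {v, partner M v}) v (partner M v))"
    using draw_rays_disjoint[OF vs(1)] rays_disjoint[OF c] vs(2) by simp
  moreover have "extended_segment (obstacles C M R e) e =
      convex hull e \<union> (\<Union>v\<in>e. drawn_ray (obstacles C M R {v, partner M v}) v (partner M v))"
    if e: "e \<in> level_edges c" for e
  proof -
    have "{v, partner M v} = e" "e - {v} = {partner M v}" if "v \<in> e" for v
    proof -
      have "e \<in> M" using e level_edges_subset by blast
      from edge_partner[OF this that] show "{v, partner M v} = e" "e - {v} = {partner M v}" by auto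
    qed
    then show ?thesis unfolding extended_segment_def by simp
  qed
  ultimately show ?thesis by auto
qed

lemma extended_horizontal:
  assumes "k \<in> horizontals"
  shows "extended_segment (obstacles C M {} k) k = hx k \<times> {low_y k}"
proof -
  have "extended_segment (obstacles C M {} k) {(left_x k, low_y k), (right_x k, low_y k)} =
      (\<lambda>t. (t, low_y k)) ` prolong ((\<lambda>t. (t, low_y k)) -` obstacles C M {} k) (left_x k) (right_x k)"
    using horizontal_edge(1)[OF assms]
    by (intro extended_segment_affine[of _ "(0, low_y k)" "(1, 0)"]) (auto simp: zero_prod_def)
  then show ?thesis using horizontal_edge(3)[OF assms] unfolding hx_def vimage_def by auto
qed

lemma extended_vertical:
  assumes "j \<in> verticals"
  shows "extended_segment (obstacles C M hlines j) j = {left_x j} \<times> vy j"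
proof -
  have "extended_segment (obstacles C M hlines j) {(left_x j, low_y j), (left_x j, high_y j)} =
      (\<lambda>t. (left_x j, t)) ` prolong ((\<lambda>t. (left_x j, t)) -` obstacles C M hlines j) (low_y j) (high_y j)"
    using vertical_edge(1)[OF assms]
    by (intro extended_segment_affine[of _ "(left_x j, 0)" "(0, 1)"]) (auto simp: zero_prod_def)
  then show ?thesis using vertical_edge(3)[OF assms] unfolding vy_def vimage_def by auto
qed

lemma extension_L: "extension C M L"
proof -
  have "finite (\<Union>(level_edges c))" for c
    using finite_level_edges finite_edge level_edges_subset by blast
  then obtain hs vs where hs: "set hs = \<Union>horizontals" "distinct hs"
    and vs: "set vs = \<Union>verticals" "distinct vs"
    using finite_distinct_list by metis
  let ?R = "draw_rays C M {} hs"
  have hulls: "(\<Union>e\<in>M. convex hull e) = (\<Union>k\<in>horizontals. convex hull k) \<union> (\<Union>j\<in>verticals. convex hull j)"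
    using M_eq by blast
  have hlines: "(\<Union>k\<in>horizontals. convex hull k) \<union> ?R = hlines"
    using draw_level_edges[of snd hs "{}"] hs unfolding hlines_def by (simp add: extended_horizontal)
  have "obstacles C M ?R j = obstacles C M hlines j" if "j \<in> verticals" for j
    using that hlines level_edges_subset[of snd] horizontals_verticals_disjoint
      unfolding obstacles_def by blast
  then have "(\<Union>j\<in>verticals. convex hull j) \<union> draw_rays C M ?R vs = ?R \<union> (\<Union>j\<in>verticals. {left_x j} \<times> vy j)"
    using draw_level_edges[of fst vs ?R] vs by (simp add: extended_vertical)
  then have "L = (\<Union>e\<in>M. convex hull e) \<union> draw_rays C M {} (hs @ vs)"
    unfolding L_eq draw_rays_append hulls hlines[symmetric] by blast
  moreover have "\<Union>horizontals \<inter> \<Union>verticals = {}"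
    using edge_eq level_edges_subset horizontals_verticals_disjoint by blast
  then have "distinct (hs @ vs)" using hs vs by simp
  moreover have "set (hs @ vs) = \<Union>M" using hs(1) vs(1) M_eq by auto
  ultimately show ?thesis unfolding extension_def by blast
qed

lemma marked_eq: "marked = (\<lambda>e. (left_x e, low_y e)) ` M"
  unfolding marked_def using M_eq by blast

lemma unmarked_eq: "unmarked = (\<lambda>e. (right_x e, high_y e)) ` M"
proof -
  have "(\<lambda>e. (right_x e, high_y e)) ` M =
    (\<lambda>e. (right_x e, high_y e)) ` horizontals \<union> (\<lambda>e. (right_x e, high_y e)) ` verticals"
    using M_eq by blast
  then show ?thesis unfolding unmarked_def by (simp add: horizontal_edge(2) vertical_edge(2))
qed

lemma edge_ends:
  assumes "e \<in> M"
  shows "e = {(left_x e, low_y e), (right_x e, high_y e)}" "(left_x e, low_y e) \<noteq> (right_x e, high_y e)"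
  using edge_coordinates[OF assms] by auto

lemma marked_unmarked_partition: "marked \<union> unmarked = \<Union>M" "marked \<inter> unmarked = {}"
proof -
  show "marked \<union> unmarked = \<Union>M" unfolding marked_eq unmarked_eq using edge_ends(1) by blast
  have "(left_x e, low_y e) \<noteq> (right_x f, high_y f)" if ef: "e \<in> M" "f \<in> M" for e f
  proof
    assume eq: "(left_x e, low_y e) = (right_x f, high_y f)"
    have "(left_x e, low_y e) \<in> e" "(right_x f, high_y f) \<in> f" using edge_ends(1) ef by blast+
    then have "e = f" using edge_eq[OF ef] eq by simp
    then show False using edge_ends(2)[OF ef(1)] eq by simp
  qed
  then show "marked \<inter> unmarked = {}" unfolding marked_eq unmarked_eq by blast
qed

lemma ends_in_different_parts:
  assumes "{v, w} \<in> M"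
  shows "v \<in> marked \<and> w \<in> unmarked \<or> v \<in> unmarked \<and> w \<in> marked"
proof -
  define e where "e = {v, w}"
  have "(left_x e, low_y e) \<in> marked" "(right_x e, high_y e) \<in> unmarked"
    unfolding marked_eq unmarked_eq using assms e_def by blast+
  moreover have "{v, w} = {(left_x e, low_y e), (right_x e, high_y e)}"
    using edge_ends(1)[of e] assms e_def by simp
  ultimately show ?thesis by (auto simp: doubleton_eq_iff)
qed

theorem two_trees:
  assumes "M \<noteq> {}"
  shows "edge_partition_into_two_trees (dual_multigraph C M L)
    (dual_subgraph C L marked) (dual_subgraph C L unmarked)"
proof -
  interpret dissection: convex_dissection C L
    by unfold_locales (use convex_C closed_L I_subset_closure_A assms interior_C_nonempty in auto)
  have "is_tree (dual_subgraph C L marked)" "is_tree (dual_subgraph C L unmarked)"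
    using dissection.is_tree_dual_subgraph[OF finite_marked marked_subset_L spans_dual_tree_marked]
      dissection.is_tree_dual_subgraph[OF finite_unmarked unmarked_subset_L spans_dual_tree_unmarked] .
  then show ?thesis
    unfolding edge_partition_into_two_trees_def dual_multigraph_eq subgraph_def
    using marked_unmarked_partition by auto
qed

end

lemma no_edges_two_trees:
  assumes "convex C" "C \<noteq> {}"
  shows "extension C {} {}"
    and "edge_partition_into_two_trees (dual_multigraph C {} {})
      (dual_multigraph C {} {}) (dual_multigraph C {} {})"
proof -
  show "extension C {} {}" unfolding extension_def by (intro exI[of _ "[]"]) simp
  have "cells C {} = {C}"
    unfolding cells_def using assms by (simp add: components_eq_sing_iff convex_connected)
  then have "is_tree (dual_multigraph C {} {})"
    unfolding is_tree_def wf_multigraph_def connected_graph_def is_cycle_def dual_multigraph_def by simp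
  then show "edge_partition_into_two_trees (dual_multigraph C {} {})
    (dual_multigraph C {} {}) (dual_multigraph C {} {})"
    unfolding edge_partition_into_two_trees_def subgraph_def by (simp add: dual_multigraph_def)
qed

theorem theorem11:
  fixes P :: "point set" and M :: "point set set" and C :: "point set"
  assumes "perfect_matching P M"
    and "general_position P"
    and "axis_parallel M"
    and "convex C" and "C \<noteq> {}"
    and "\<forall>e\<in>M. convex hull e \<subseteq> C"
    and "\<forall>e\<in>M. \<not> convex hull e \<subseteq> frontier C"
  shows "\<exists>L. extension C M L \<and>
           (\<exists>S T. edge_partition_into_two_trees (dual_multigraph C M L) S T \<and>
              (\<forall>v w. {v, w} \<in> M \<longrightarrow>
                 (v \<in> edges S \<and> w \<in> edges T) \<or> (v \<in> edges T \<and> w \<in> edges S)))"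
proof (cases "M = {}")
  case True
  then show ?thesis using no_edges_two_trees[OF assms(4,5)] by blast
next
  case False
  interpret axis_matching P M C using assms by unfold_locales auto
  have "\<forall>v w. {v, w} \<in> M \<longrightarrow>
      v \<in> edges (dual_subgraph C L marked) \<and> w \<in> edges (dual_subgraph C L unmarked) \<or>
      v \<in> edges (dual_subgraph C L unmarked) \<and> w \<in> edges (dual_subgraph C L marked)"
    using ends_in_different_parts unfolding dual_subgraph_simps by blast
  then show ?thesis using extension_L two_trees[OF False] by blast
qed

end
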